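(* Let $n\ge2$, let $f\in C^0(\mathbb R^{n+1}_-)$ have compact support, let $T:=\sup\{-t: f(x,t)\neq0\text{ for some }x\in\mathbb R^n\}$, and let $u\in C^0(\mathbb R^{n+1}_-)$ be a viscosity solution to $$u_t=\sum_{i=1}^n\arctan\lambda_i(D^2u)+f(x,t)\quad\text{in }\mathbb R^{n+1}_-.$$ Assume that Liouville type rigidity holds for the equation with $f\equiv0$, in the following sense: there is a class $\mathcal C\subset C^0(\mathbb R^{n+1}_-)$ such that every $v\in\mathcal C$ which is a viscosity solution to $v_t=\sum_{i=1}^n\arctan\lambda_i(D^2v)$ in $\mathbb R^{n+1}_-$ has the form $$v(x,t)=\tau t+\tfrac12x'Ax+b\cdot x+c,\quad A\in\mathrm{Sym}(n),\ b\in\mathbb R^n,\ c\in\mathbb R,\ \tau=\sum_{i=1}^n\arctan\lambda_i(A),$$ and the function $(x,t)\mapsto u(x,t-T)$ on $\mathbb R^{n+1}_-$ belongs to $\mathcal C$. Then there exist $A\in\mathrm{Sym}(n)$, $b\in\mathbb R^n$, $c\in\mathbb R$ such that, with $\tau:=\sum_{i=1}^n\arctan\lambda_i(A)$ and $$E(x,t):=u(x,t)-\left(\tau t+\tfrac12x'Ax+b\cdot x+c\right),$$ for any $\zeta>0$ there exists $C>0$ with $$|E(x,t)|\le C|x|^{-\zeta},\quad\forall\,(x,t)\in\mathbb R^n\times(-T,0]$$ (the right-hand side being $+\infty$ at $x=0$).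
   Context: $\mathbb R^{n+1}_-:=\mathbb R^n\times(-\infty,0]$; $\mathrm{Sym}(n)$ is the space of real symmetric $n\times n$ matrices; $\lambda_i(M)$ are the eigenvalues of $M$; $D^2$ is the Hessian in $x$; $x'$ is the transpose. Viscosity solution: a continuous $u$ is a viscosity subsolution (supersolution) of $u_t=\sum_i\arctan\lambda_i(D^2u)+f$ if, whenever $\varphi\in C^{2,1}$ and $u-\varphi$ has a local maximum (minimum) at $(\bar x,\bar t)$ relative to $\{|x-\bar x|<r,\ \bar t-r^2<t\le\bar t\}$ for some $r>0$, one has $\varphi_t\le\sum_i\arctan\lambda_i(D^2\varphi)+f$ (respectively $\ge$) at $(\bar x,\bar t)$. A viscosity solution is both. *)

theory Defs
  imports "HOL-Analysis.Analysis" "HOL-Computational_Algebra.Computational_Algebra"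
begin

text \<open>Space-time points are pairs \<open>(x, t)\<close>. Functions on \<open>Rminus\<close> are represented by total
  functions whose values at positive times are irrelevant to everything below.\<close>

definition Rminus :: "((real^'n) \<times> real) set" where
  "Rminus = UNIV \<times> {..0}"

definition C0_minus :: "((real^'n) \<times> real \<Rightarrow> real) set" where
  "C0_minus = {u. continuous_on Rminus u}"

definition Sym :: "(real^'n^'n) set" where
  "Sym = {A. transpose A = A}"

definition charpoly :: "real^'n^'n \<Rightarrow> real poly" where
  "charpoly M = det (\<chi> i j. if i = j then [:- M $ i $ j, 1:] else [:- M $ i $ j:])"

text \<open>Eigenvalues counted with algebraic multiplicity; \<open>proots\<close> sees only real roots, which for
  \<open>M \<in> Sym\<close> are all the roots.\<close>

definition eigenvalues :: "real^'n^'n \<Rightarrow> real multiset" where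
  "eigenvalues M = proots (charpoly M)"

definition sum_arctan :: "real^'n^'n \<Rightarrow> real" where
  "sum_arctan M = (\<Sum>\<mu>\<in>#eigenvalues M. arctan \<mu>)"

text \<open>\<open>\<phi>\<close> is \<open>C\<^sup>2\<^sup>,\<^sup>1\<close> on \<open>Rminus\<close>, with time derivative \<open>p\<close>, spatial gradient \<open>g\<close> and spatial
  Hessian \<open>H\<close>. The time derivative is one-sided at \<open>t = 0\<close>.\<close>

definition C21_with ::
  "((real^'n) \<times> real \<Rightarrow> real) \<Rightarrow> ((real^'n) \<times> real \<Rightarrow> real) \<Rightarrow>
   ((real^'n) \<times> real \<Rightarrow> real^'n) \<Rightarrow> ((real^'n) \<times> real \<Rightarrow> real^'n^'n) \<Rightarrow> bool" where
  "C21_with \<phi> p g H \<longleftrightarrow>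
     continuous_on Rminus \<phi> \<and> continuous_on Rminus p \<and>
     continuous_on Rminus g \<and> continuous_on Rminus H \<and>
     (\<forall>x t. (x, t) \<in> Rminus \<longrightarrow>
        ((\<lambda>s. \<phi> (x, s)) has_real_derivative p (x, t)) (at t within {..0}) \<and>
        (GDERIV (\<lambda>y. \<phi> (y, t)) x :> g (x, t)) \<and>
        ((\<lambda>y. g (y, t)) has_derivative (\<lambda>h. H (x, t) *v h)) (at x))"

definition parabolic_cylinder :: "real^'n \<Rightarrow> real \<Rightarrow> real \<Rightarrow> ((real^'n) \<times> real) set" where
  "parabolic_cylinder x0 t0 r = {(x, t). norm (x - x0) < r \<and> t0 - r\<^sup>2 < t \<and> t \<le> t0}"

definition local_max_at ::
  "((real^'n) \<times> real \<Rightarrow> real) \<Rightarrow> real^'n \<Rightarrow> real \<Rightarrow> bool" where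
  "local_max_at w x0 t0 \<longleftrightarrow> (\<exists>r>0. \<forall>z\<in>parabolic_cylinder x0 t0 r. w z \<le> w (x0, t0))"

definition local_min_at ::
  "((real^'n) \<times> real \<Rightarrow> real) \<Rightarrow> real^'n \<Rightarrow> real \<Rightarrow> bool" where
  "local_min_at w x0 t0 \<longleftrightarrow> (\<exists>r>0. \<forall>z\<in>parabolic_cylinder x0 t0 r. w (x0, t0) \<le> w z)"

definition viscosity_subsolution ::
  "((real^'n) \<times> real \<Rightarrow> real) \<Rightarrow> ((real^'n) \<times> real \<Rightarrow> real) \<Rightarrow> bool" where
  "viscosity_subsolution f u \<longleftrightarrow> u \<in> C0_minus \<and>
     (\<forall>\<phi> p g H x0 t0. C21_with \<phi> p g H \<and> (x0, t0) \<in> Rminus \<and>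
        local_max_at (\<lambda>z. u z - \<phi> z) x0 t0 \<longrightarrow>
        p (x0, t0) \<le> sum_arctan (H (x0, t0)) + f (x0, t0))"

definition viscosity_supersolution ::
  "((real^'n) \<times> real \<Rightarrow> real) \<Rightarrow> ((real^'n) \<times> real \<Rightarrow> real) \<Rightarrow> bool" where
  "viscosity_supersolution f u \<longleftrightarrow> u \<in> C0_minus \<and>
     (\<forall>\<phi> p g H x0 t0. C21_with \<phi> p g H \<and> (x0, t0) \<in> Rminus \<and>
        local_min_at (\<lambda>z. u z - \<phi> z) x0 t0 \<longrightarrow>
        p (x0, t0) \<ge> sum_arctan (H (x0, t0)) + f (x0, t0))"

definition viscosity_solution ::
  "((real^'n) \<times> real \<Rightarrow> real) \<Rightarrow> ((real^'n) \<times> real \<Rightarrow> real) \<Rightarrow> bool" where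
  "viscosity_solution f u \<longleftrightarrow> viscosity_subsolution f u \<and> viscosity_supersolution f u"

definition compactly_supported :: "((real^'n) \<times> real \<Rightarrow> real) \<Rightarrow> bool" where
  "compactly_supported f \<longleftrightarrow> compact (closure {z \<in> Rminus. f z \<noteq> 0})"

text \<open>The inserted \<open>0\<close> fixes the convention \<open>sup {} = 0\<close> when \<open>f\<close> vanishes identically; otherwise
  it has no effect, as \<open>- t \<ge> 0\<close> on \<open>Rminus\<close>.\<close>

definition time_extent :: "((real^'n) \<times> real \<Rightarrow> real) \<Rightarrow> real" where
  "time_extent f = Sup (insert 0 {- t | x t. (x, t) \<in> Rminus \<and> f (x, t) \<noteq> 0})"

definition quad :: "real \<Rightarrow> real^'n^'n \<Rightarrow> real^'n \<Rightarrow> real \<Rightarrow> real^'n \<Rightarrow> real \<Rightarrow> real" where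
  "quad \<tau> A b c x t = \<tau> * t + 1/2 * (x \<bullet> (A *v x)) + b \<bullet> x + c"

end

theory Submission
  imports Defs
begin

text \<open>Rigidity, applied to the translate of \<open>u\<close> by \<open>T\<close> in time, shows that \<open>u\<close> equals a quadratic
  solution \<open>Q\<close> for \<open>t \<le> - T\<close>. As the operator is bounded, \<open>u - Q\<close> is bounded on the remaining
  finite time interval, so it can be compared with barriers on all of space. The operator is
  Lipschitz at the Hessian \<open>A\<close> of \<open>Q\<close>, and the second derivatives of \<open>(1 + \<bar>x\<bar>\<^sup>2) powr k\<close> are bounded
  by a multiple of the function itself. Hence, for \<open>l\<close> and \<open>K\<close> large,
  \<open>K exp (l t) (1 + \<bar>x\<bar>\<^sup>2) powr (- \<zeta> / 2)\<close> bounds \<open>\<bar>u - Q\<bar>\<close> by the comparison principle with smooth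
  functions.\<close>

section \<open>Eigenvalues of symmetric matrices\<close>

text \<open>\<open>Q\<close> and the barriers are smooth, so \<open>Q\<close> plus or minus a
  barrier is itself a test function for \<open>u\<close>: comparison needs no doubling of variables,
  only a maximum point on a compact cylinder. The obstacle is that space is unbounded and no growth
  rate of \<open>u\<close> in the strip is known beforehand. Hence two stages: boundedness of
  \<open>u - Q\<close> costs only the boundedness of the operator, and once it is known, an
  arbitrarily small multiple of 1 + |x|^2 closes the cylinder laterally. Every rate \<zeta> is
  reached because the strip has finite height \<open>T\<close>: \<open>l\<close> depends on \<zeta>,
  but \<open>exp (l * t)\<close> stays between \<open>exp (- (l * T))\<close> and 1. The operator is
  defined through the roots of the characteristic polynomial, which gives no direct hold on its
  variation. Its Lipschitz bound at \<open>A\<close> comes from comparing orthonormal eigenbases of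
  \<open>A\<close> and \<open>A + B\<close>; this is what the spectral theorem is for.\<close>

lemma symmetric_dot:
  fixes M :: "real^'n^'n"
  assumes "transpose M = M"
  shows "x \<bullet> (M *v y) = (M *v x) \<bullet> y"
  by (metis assms dot_lmul_matrix transpose_matrix_vector)

text \<open>For small s of sign opposite to \<open>a\<close> the linear term wins. This replaces
  differentiation at a maximum point of the Rayleigh quotient.\<close>

lemma quadratic_nonneg_linear_coeff:
  fixes a b :: real
  assumes "\<And>s. 0 \<le> s * a + s\<^sup>2 * b"
  shows "a = 0"
proof (rule ccontr)
  assume a: "a \<noteq> 0"
  define c where "c = \<bar>b\<bar> + 1"
  have c: "c > 0" "b < c" by (auto simp: c_def)
  have "0 \<le> (- a / c) * a + (- a / c)\<^sup>2 * b" by (rule assms)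
  also have "\<dots> = a\<^sup>2 / c * (b / c - 1)"
    using c by (simp add: field_simps power2_eq_square)
  also have "\<dots> < 0"
    using a c by (intro mult_pos_neg) (auto simp: field_simps)
  finally show False by simp
qed

text \<open>A maximizer of the quadratic form on the unit sphere of \<open>S\<close> is an
  eigenvector: the residual \<open>M *v v - d *\<^sub>R v\<close> lies in \<open>S\<close> by
  invariance, and varying the maximizer in its direction forces it to vanish.\<close>

lemma symmetric_eigenvector_in_subspace:
  fixes M :: "real^'n^'n"
  assumes sym: "transpose M = M" and S: "subspace S" and inv: "\<And>x. x \<in> S \<Longrightarrow> M *v x \<in> S"
    and nz: "dim S \<noteq> 0"
  obtains v d where "v \<in> S" "norm v = 1" "M *v v = d *\<^sub>R v"
proof -
  define K where "K = S \<inter> sphere 0 1"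
  obtain y where y: "y \<in> S" "y \<noteq> 0"
    using nz dim_eq_0[of S] by auto
  have "y /\<^sub>R norm y \<in> K"
    using y S by (auto simp: K_def subspace_scale)
  hence ne: "K \<noteq> {}" by blast
  have comp: "compact K"
    unfolding K_def by (rule closed_Int_compact[OF closed_subspace[OF S] compact_sphere])
  have cont: "continuous_on K (\<lambda>x. x \<bullet> (M *v x))"
    by (intro continuous_intros matrix_vector_mult_linear_continuous_on)
  obtain v where v: "v \<in> K" and max: "\<And>x. x \<in> K \<Longrightarrow> x \<bullet> (M *v x) \<le> v \<bullet> (M *v v)"
    using continuous_attains_sup[OF comp ne cont] by auto
  define d where "d = v \<bullet> (M *v v)"
  have vS: "v \<in> S" and v1: "norm v = 1" using v by (auto simp: K_def)
  have bound: "x \<bullet> (M *v x) \<le> d * (x \<bullet> x)" if "x \<in> S" for x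
  proof (cases "x = 0")
    case False
    have "x /\<^sub>R norm x \<in> K"
      using that False S by (auto simp: K_def subspace_scale)
    from max[OF this] have "(x \<bullet> (M *v x)) / (norm x)\<^sup>2 \<le> d"
      by (simp add: d_def matrix_vector_mult_scaleR power2_eq_square divide_simps)
    thus ?thesis using False
      by (simp add: divide_simps power2_norm_eq_inner)
  qed simp
  define w where "w = M *v v - d *\<^sub>R v"
  have wS: "w \<in> S"
    unfolding w_def using inv vS S by (simp add: subspace_diff subspace_scale)
  have "-2 * (w \<bullet> w) = 0"
  proof (rule quadratic_nonneg_linear_coeff)
    fix s :: real
    have "v + s *\<^sub>R w \<in> S" using vS wS S by (simp add: subspace_add subspace_scale)
    from bound[OF this]
    have "v \<bullet> (M *v v) + s * (v \<bullet> (M *v w)) + s * (w \<bullet> (M *v v)) + s\<^sup>2 * (w \<bullet> (M *v w))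
        \<le> d * (v \<bullet> v + 2 * s * (v \<bullet> w) + s\<^sup>2 * (w \<bullet> w))"
      by (simp add: matrix_vector_mult_scaleR matrix_vector_right_distrib inner_add_left
          inner_add_right inner_commute algebra_simps power2_eq_square)
    moreover have "v \<bullet> (M *v w) = w \<bullet> (M *v v)"
      using symmetric_dot[OF sym, of v w] by (simp add: inner_commute)
    moreover have "v \<bullet> v = 1" using v1 by (simp add: norm_eq_1)
    moreover have "w \<bullet> w = w \<bullet> (M *v v) - d * (v \<bullet> w)"
    proof -
      have "w \<bullet> w = w \<bullet> (M *v v) - d * (w \<bullet> v)"
        using inner_diff_right[of w "M *v v" "d *\<^sub>R v"] by (simp flip: w_def)
      thus ?thesis by (simp add: inner_commute)
    qed
    hence "s * (w \<bullet> w) = s * (w \<bullet> (M *v v)) - s * (d * (v \<bullet> w))"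
      by (simp add: right_diff_distrib)
    moreover have "v \<bullet> (M *v v) = d" by (simp add: d_def)
    ultimately show "0 \<le> s * (-2 * (w \<bullet> w)) + s\<^sup>2 * (d * (w \<bullet> w) - w \<bullet> (M *v w))"
      by (simp add: algebra_simps)
  qed
  hence "w = 0" by simp
  hence "M *v v = d *\<^sub>R v" by (simp add: w_def)
  with vS v1 show ?thesis by (rule that)
qed

text \<open>By symmetry the orthogonal complement of the eigenvectors already found is invariant,
  and it is nonzero while there are fewer than \<open>CARD('n)\<close> of them, so it contains a
  further one.\<close>

lemma symmetric_orthonormal_eigenvectors:
  fixes M :: "real^'n^'n"
  assumes sym: "transpose M = M" and "k \<le> CARD('n)"
  shows "\<exists>B. finite B \<and> card B = k \<and> pairwise orthogonal B \<and>
    (\<forall>v\<in>B. norm v = 1 \<and> (\<exists>d. M *v v = d *\<^sub>R v))"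
  using assms(2)
proof (induction k)
  case 0
  show ?case by (intro exI[of _ "{}"]) auto
next
  case (Suc k)
  then obtain B where B: "finite B" "card B = k" "pairwise orthogonal B"
    and eig: "\<And>v. v \<in> B \<Longrightarrow> norm v = 1 \<and> (\<exists>d. M *v v = d *\<^sub>R v)" by auto
  define S where "S = {y. \<forall>x\<in>span B. orthogonal x y}"
  have "dim S + dim (span B) = dim (UNIV :: (real^'n) set)"
    unfolding S_def using dim_subspace_orthogonal_to_vectors[of "span B" UNIV] by simp
  moreover have "dim (span B) \<le> k"
    using B by (metis dim_le_card' dim_span)
  ultimately have "dim S \<noteq> 0" using Suc.prems by (simp del: dim_eq_0)
  moreover have subS: "subspace S"
    unfolding S_def subspace_def by (auto simp: orthogonal_clauses)
  moreover have "M *v y \<in> S" if "y \<in> S" for y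
  proof -
    have "orthogonal (M *v y) v" if "v \<in> B" for v
    proof -
      obtain d where "M *v v = d *\<^sub>R v" using eig \<open>v \<in> B\<close> by blast
      moreover have "orthogonal v y" using \<open>y \<in> S\<close> \<open>v \<in> B\<close> by (simp add: S_def span_base)
      ultimately show ?thesis
        using symmetric_dot[OF sym, of v y] by (simp add: orthogonal_def inner_commute)
    qed
    hence "orthogonal (M *v y) x" if "x \<in> span B" for x
      using that orthogonal_to_span by blast
    thus ?thesis by (simp add: S_def orthogonal_commute)
  qed
  ultimately obtain v d where v: "v \<in> S" "norm v = 1" "M *v v = d *\<^sub>R v"
    using symmetric_eigenvector_in_subspace[OF sym] by metis
  have orth: "orthogonal x v" if "x \<in> B" for x
    using v(1) that by (simp add: S_def span_base)
  hence "v \<notin> B" using v(2) by (force simp: orthogonal_def norm_eq_1)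
  show ?case
  proof (intro exI[of _ "insert v B"] conjI)
    show "pairwise orthogonal (insert v B)"
      using B(3) orth by (auto simp: pairwise_insert orthogonal_commute)
  qed (use B eig v \<open>v \<notin> B\<close> in auto)
qed

lemma symmetric_diagonalization:
  fixes M :: "real^'n^'n"
  assumes sym: "transpose M = M"
  obtains P :: "real^'n^'n" and d where "orthogonal_matrix P" "\<And>i. M *v (P $ i) = d i *\<^sub>R (P $ i)"
proof -
  obtain B where B: "finite B" "card B = CARD('n)" "pairwise orthogonal B"
    and eig: "\<And>v. v \<in> B \<Longrightarrow> norm v = 1 \<and> (\<exists>d. M *v v = d *\<^sub>R v)"
    using symmetric_orthonormal_eigenvectors[OF sym order_refl] by blast
  obtain h where h: "bij_betw h (UNIV :: 'n set) B"
    using finite_same_card_bij[of "UNIV :: 'n set" B] B by auto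
  define P :: "real^'n^'n" where "P = (\<chi> i. h i)"
  have hB: "h i \<in> B" for i using h by (auto simp: bij_betw_def)
  have row: "row i P = h i" for i by (simp add: P_def row_def vec_eq_iff)
  have "orthogonal_matrix P"
    unfolding orthogonal_matrix_orthonormal_rows row
    using eig[OF hB] B(3) h hB by (auto simp: pairwise_def bij_betw_def inj_on_eq_iff)
  moreover have "\<forall>i. \<exists>d. M *v (P $ i) = d *\<^sub>R (P $ i)"
    using eig[OF hB] by (simp add: P_def)
  ultimately show ?thesis using that by metis
qed

lemma orthogonal_matrix_Parseval:
  fixes P :: "real^'n^'n"
  assumes "orthogonal_matrix P"
  shows "(\<Sum>i\<in>UNIV. (P $ i \<bullet> x) * (P $ i \<bullet> y)) = x \<bullet> y"
proof -
  have "orthogonal_transformation ((*v) P)"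
    using assms by (simp add: orthogonal_transformation_matrix)
  hence "(P *v x) \<bullet> (P *v y) = x \<bullet> y" by (simp add: orthogonal_transformation_def)
  thus ?thesis by (simp add: inner_vec_def[of "P *v x"] matrix_vector_mul_component)
qed

section \<open>Characteristic polynomial and eigenvalue multiset\<close>

lemma poly_det:
  fixes A :: "'a::comm_ring_1 poly^'n^'n"
  shows "poly (det A) x = det (\<chi> i j. poly (A $ i $ j) x)"
  unfolding det_def by (simp only: poly_sum poly_mult poly_prod poly_of_int vec_lambda_beta)

lemma poly_charpoly: "poly (charpoly M) x = det (x *\<^sub>R mat 1 - M)"
  unfolding charpoly_def poly_det
  by (intro arg_cong[of _ _ det]) (auto simp: vec_eq_iff mat_def)

text \<open>An orthonormal eigenbasis fixes the algebraic multiplicities: conjugation by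
  \<open>P\<close> makes x I - M diagonal, so the characteristic polynomial and the product of the
  factors X - d i agree at every real x, hence as polynomials.\<close>

lemma eigenvalues_diagonalized:
  fixes M P :: "real^'n^'n"
  assumes P: "orthogonal_matrix P" and eig: "\<And>i. M *v (P $ i) = d i *\<^sub>R (P $ i)"
  shows "eigenvalues M = image_mset d (mset_set UNIV)"
proof -
  have "poly (charpoly M) x = poly (\<Prod>i\<in>UNIV. [:- d i, 1:]) x" for x
  proof -
    define D :: "real^'n^'n" where "D = (\<chi> i j. if i = j then x - d i else 0)"
    have "(x *\<^sub>R mat 1 - M) ** transpose P = transpose P ** D"
    proof (simp add: vec_eq_iff, intro allI)
      fix k i
      have "((x *\<^sub>R mat 1 - M) ** transpose P) $ k $ i = ((x *\<^sub>R mat 1 - M) *v (P $ i)) $ k"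
        by (simp add: matrix_matrix_mult_def matrix_vector_mult_def transpose_def)
      also have "\<dots> = (x - d i) * P $ i $ k"
        by (simp add: matrix_vector_mult_diff_rdistrib eig algebra_simps flip: scaleR_matrix_vector_assoc)
      also have "\<dots> = (transpose P ** D) $ k $ i"
        by (simp add: matrix_matrix_mult_def transpose_def D_def if_distrib if_distribR sum.delta cong: if_cong)
      finally show "((x *\<^sub>R mat 1 - M) ** transpose P) $ k $ i = (transpose P ** D) $ k $ i" .
    qed
    hence "det (x *\<^sub>R mat 1 - M) * det P = det P * det D"
      by (metis det_mul det_transpose)
    moreover have "det P \<noteq> 0" using det_orthogonal_matrix[OF P] by auto
    ultimately have "det (x *\<^sub>R mat 1 - M) = det D" by simp
    also have "\<dots> = (\<Prod>i\<in>UNIV. x - d i)"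
      by (subst det_diagonal) (auto simp: D_def)
    finally show ?thesis by (simp add: poly_charpoly poly_prod)
  qed
  hence "charpoly M = (\<Prod>i\<in>UNIV. [:- d i, 1:])" by (intro poly_eqI_degree_lead_coeff poly_ext) auto
  hence "eigenvalues M = (\<Sum>i\<in>UNIV. {#d i#})"
    by (simp add: eigenvalues_def proots_prod)
  thus ?thesis by (simp add: sum_unfold_sum_mset)
qed

lemma sum_arctan_diagonalized:
  fixes M P :: "real^'n^'n"
  assumes "orthogonal_matrix P" and "\<And>i. M *v (P $ i) = d i *\<^sub>R (P $ i)"
  shows "sum_arctan M = (\<Sum>i\<in>UNIV. arctan (d i))"
  unfolding sum_arctan_def eigenvalues_diagonalized[OF assms]
  by (simp add: sum_unfold_sum_mset image_mset.compositionality comp_def)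

section \<open>Boundedness and Lipschitz continuity of the operator\<close>

lemma degree_charpoly_le: "degree (charpoly (M :: real^'n^'n)) \<le> CARD('n)"
  unfolding charpoly_def det_def
proof (rule degree_sum_le)
  fix p :: "'n \<Rightarrow> 'n"
  let ?C = "\<chi> i j. if i = j then [:- M $ i $ j, 1:] else [:- M $ i $ j:]"
  have "degree (of_int (sign p) * (\<Prod>i\<in>UNIV. ?C $ i $ p i)) \<le> degree (\<Prod>i\<in>UNIV. ?C $ i $ p i)"
    using degree_mult_le[of "of_int (sign p)" "\<Prod>i\<in>UNIV. ?C $ i $ p i"] by simp
  also have "\<dots> \<le> (\<Sum>i\<in>UNIV. degree (?C $ i $ p i))"
    using degree_prod_sum_le[of UNIV "\<lambda>i. ?C $ i $ p i"] by (simp add: comp_def)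
  also have "\<dots> \<le> (\<Sum>i\<in>(UNIV :: 'n set). 1)"
    by (intro sum_mono) auto
  finally show "degree (of_int (sign p) * (\<Prod>i\<in>UNIV. ?C $ i $ p i)) \<le> CARD('n)" by simp
qed simp

lemma sum_arctan_bound: "\<bar>sum_arctan (M :: real^'n^'n)\<bar> \<le> 2 * CARD('n)"
proof -
  have at: "\<bar>arctan y\<bar> \<le> 2" for y
    using arctan_bounded[of y] pi_less_4 by auto
  have "\<bar>\<Sum>y\<in>#X. arctan y\<bar> \<le> 2 * real (size X)" for X
  proof (induction X)
    case (add y X)
    then show ?case using at[of y] by simp
  qed simp
  from this[of "eigenvalues M"]
  have "\<bar>sum_arctan M\<bar> \<le> 2 * real (size (eigenvalues M))" by (simp add: sum_arctan_def)
  also have "size (eigenvalues M) \<le> CARD('n)"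
    unfolding eigenvalues_def using size_proots_le degree_charpoly_le order_trans by blast
  finally show ?thesis by simp
qed

text \<open>The mean value theorem gives the slope 1 / (1 + z^2) with z between \<open>a\<close> and
  \<open>m\<close>, and this slope is 1-Lipschitz in z. The remainder constant does not depend on
  \<open>a\<close>.\<close>

lemma arctan_second_order: "\<bar>arctan m - arctan a - (m - a) / (1 + a\<^sup>2)\<bar> \<le> (m - a)\<^sup>2"
proof -
  have "\<exists>z. \<bar>z - a\<bar> \<le> \<bar>m - a\<bar> \<and> arctan m - arctan a = (m - a) / (1 + z\<^sup>2)"
  proof (cases m a rule: linorder_cases)
    case less
    obtain z where z: "m < z" "z < a" "arctan a - arctan m = (a - m) * inverse (1 + z\<^sup>2)"
      using MVT2[of m a arctan "\<lambda>z. inverse (1 + z\<^sup>2)"] less DERIV_arctan by metis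
    have "arctan m - arctan a = - (arctan a - arctan m)" by simp
    also have "\<dots> = (m - a) / (1 + z\<^sup>2)"
      unfolding z(3) by (metis divide_inverse minus_diff_eq mult_minus_left)
    finally show ?thesis using z(1,2) by (intro exI[of _ z]) auto
  next
    case greater
    obtain z where "a < z" "z < m" "arctan m - arctan a = (m - a) * inverse (1 + z\<^sup>2)"
      using MVT2[of a m arctan "\<lambda>z. inverse (1 + z\<^sup>2)"] greater DERIV_arctan by metis
    thus ?thesis by (intro exI[of _ z]) (auto simp: field_simps)
  qed auto
  then obtain z where z: "\<bar>z - a\<bar> \<le> \<bar>m - a\<bar>" "arctan m - arctan a = (m - a) / (1 + z\<^sup>2)" by blast
  have pos: "1 + z\<^sup>2 > 0" "1 + a\<^sup>2 > 0" by (auto simp: add_pos_nonneg)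
  have "1 / (1 + z\<^sup>2) - 1 / (1 + a\<^sup>2) = (a - z) * ((a + z) / ((1 + z\<^sup>2) * (1 + a\<^sup>2)))"
    using pos by (simp add: divide_simps) (simp add: algebra_simps power2_eq_square)
  moreover have "\<bar>(a + z) / ((1 + z\<^sup>2) * (1 + a\<^sup>2))\<bar> \<le> 1"
  proof -
    have "\<bar>a\<bar> + \<bar>z\<bar> \<le> 1 + a\<^sup>2 + z\<^sup>2"
      using zero_le_power2[of "\<bar>a\<bar> - 1/2"] zero_le_power2[of "\<bar>z\<bar> - 1/2"]
      by (simp add: power2_diff algebra_simps) (simp add: power2_eq_square)
    also have "\<dots> \<le> (1 + z\<^sup>2) * (1 + a\<^sup>2)" by (simp add: algebra_simps)
    finally have "\<bar>a + z\<bar> \<le> (1 + z\<^sup>2) * (1 + a\<^sup>2)" by linarith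
    thus ?thesis using pos by (simp add: abs_mult)
  qed
  ultimately have "\<bar>1 / (1 + z\<^sup>2) - 1 / (1 + a\<^sup>2)\<bar> \<le> \<bar>z - a\<bar>"
    by (simp only: abs_mult abs_minus_commute[of z a]) (intro mult_left_le; simp)
  hence "\<bar>1 / (1 + z\<^sup>2) - 1 / (1 + a\<^sup>2)\<bar> \<le> \<bar>m - a\<bar>" using z(1) by linarith
  hence "\<bar>m - a\<bar> * \<bar>1 / (1 + z\<^sup>2) - 1 / (1 + a\<^sup>2)\<bar> \<le> \<bar>m - a\<bar> * \<bar>m - a\<bar>"
    by (intro mult_left_mono) auto
  thus ?thesis
    unfolding z(2) by (simp add: abs_mult[symmetric] right_diff_distrib power2_eq_square)
qed

text \<open>With \<open>A p\<^sub>i = a\<^sub>i p\<^sub>i\<close> and \<open>(A + B) q\<^sub>j = m\<^sub>j q\<^sub>j\<close>, the weights \<open>(p\<^sub>i \<bullet> q\<^sub>j)\<^sup>2\<close> are doubly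
  stochastic; averaging the Taylor expansion of \<open>arctan m\<^sub>j\<close> at \<open>a\<^sub>i\<close> against them, the
  first- and second-order terms become \<open>p\<^sub>i \<bullet> B p\<^sub>i\<close> and \<open>\<bar>B p\<^sub>i\<bar>\<^sup>2\<close>.\<close>

lemma sum_arctan_perturbation:
  fixes A B :: "real^'n^'n" and \<beta> :: real
  assumes A: "transpose A = A" and B: "transpose B = B"
    and beta: "\<And>x. norm (B *v x) \<le> \<beta> * norm x"
  shows "\<bar>sum_arctan (A + B) - sum_arctan A\<bar> \<le> 4 * CARD('n) * \<beta>"
proof (cases "\<beta> \<le> 1")
  \<comment> \<open>For \<beta> > 1 the global bound on the operator suffices; for \<beta> \<le> 1
    the second-order term, of size \<beta>^2, is at most \<beta>.\<close>
  case False
  have "\<bar>sum_arctan (A + B) - sum_arctan A\<bar> \<le> 4 * real CARD('n)"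
    using sum_arctan_bound[of A] sum_arctan_bound[of "A + B"] by linarith
  also have "\<dots> \<le> 4 * CARD('n) * \<beta>" using False by simp
  finally show ?thesis .
next
  case True
  have "transpose (A + B) = A + B" using A B by (simp add: transpose_def vec_eq_iff)
  then obtain Q :: "real^'n^'n" and m where Q: "orthogonal_matrix Q" and m: "\<And>i. (A + B) *v (Q $ i) = m i *\<^sub>R (Q $ i)"
    using symmetric_diagonalization by blast
  obtain P :: "real^'n^'n" and a where P: "orthogonal_matrix P" and a: "\<And>i. A *v (P $ i) = a i *\<^sub>R (P $ i)"
    using symmetric_diagonalization[OF A] by blast
  have symAB: "x \<bullet> ((A + B) *v y) = ((A + B) *v x) \<bullet> y" for x y
    by (rule symmetric_dot) fact
  have nP: "P $ i \<bullet> P $ i = 1" for i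
    using P unfolding orthogonal_matrix_orthonormal_rows
    by (metis norm_eq_1 row_def vec_lambda_eta)
  have nQ: "Q $ i \<bullet> Q $ i = 1" for i
    using Q unfolding orthogonal_matrix_orthonormal_rows
    by (metis norm_eq_1 row_def vec_lambda_eta)
  have \<beta>0: "0 \<le> \<beta>"
    using order_trans[OF norm_ge_zero beta[of "P $ undefined"]] nP[of undefined]
    by (simp add: norm_eq_1[symmetric])
  define s where "s i j = (Q $ j \<bullet> P $ i)\<^sup>2" for i j
  have s1: "(\<Sum>j\<in>UNIV. s i j) = 1" for i
    using orthogonal_matrix_Parseval[OF Q, of "P $ i" "P $ i"] nP
    by (simp add: s_def power2_eq_square)
  have s2: "(\<Sum>i\<in>UNIV. s i j) = 1" for j
    using orthogonal_matrix_Parseval[OF P, of "Q $ j" "Q $ j"] nQ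
    by (simp add: s_def power2_eq_square inner_commute)
  \<comment> \<open>Moving the symmetric \<open>A + B\<close> onto its eigenvector
    \<open>Q $ j\<close> turns the entry of \<open>B\<close> between the two bases into eigenvalue
    gap times overlap.\<close>
  have key: "Q $ j \<bullet> (B *v (P $ i)) = (m j - a i) * (Q $ j \<bullet> P $ i)" for i j
  proof -
    have "B *v (P $ i) = (A + B) *v (P $ i) - a i *\<^sub>R (P $ i)"
      by (simp add: matrix_vector_mult_add_rdistrib a)
    hence "Q $ j \<bullet> (B *v (P $ i)) = Q $ j \<bullet> ((A + B) *v (P $ i)) - a i * (Q $ j \<bullet> P $ i)"
      by (simp only: inner_diff_right inner_scaleR_right)
    thus ?thesis by (simp only: symAB m inner_scaleR_left left_diff_distrib)
  qed
  have first: "(\<Sum>j\<in>UNIV. s i j * (m j - a i)) = P $ i \<bullet> (B *v (P $ i))" for i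
    using orthogonal_matrix_Parseval[OF Q, of "P $ i" "B *v (P $ i)"]
    by (simp add: s_def power2_eq_square key algebra_simps)
  have second: "(\<Sum>j\<in>UNIV. s i j * (m j - a i)\<^sup>2) = (B *v (P $ i)) \<bullet> (B *v (P $ i))" for i
    using orthogonal_matrix_Parseval[OF Q, of "B *v (P $ i)" "B *v (P $ i)"]
    by (simp add: s_def power2_eq_square key algebra_simps)
  have row_bound: "\<bar>\<Sum>j\<in>UNIV. s i j * (arctan (m j) - arctan (a i))\<bar> \<le> 2 * \<beta>" for i
  proof -
    let ?r = "\<lambda>j. arctan (m j) - arctan (a i) - (m j - a i) / (1 + (a i)\<^sup>2)"
    have nB: "norm (B *v (P $ i)) \<le> \<beta>"
      using beta[of "P $ i"] nP[of i] by (simp add: norm_eq_1[symmetric])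
    have "(\<Sum>j\<in>UNIV. s i j * (arctan (m j) - arctan (a i)))
        = (\<Sum>j\<in>UNIV. s i j * ?r j) + (\<Sum>j\<in>UNIV. s i j * (m j - a i)) / (1 + (a i)\<^sup>2)"
      by (simp add: sum_divide_distrib algebra_simps flip: sum.distrib)
    moreover have "\<bar>\<Sum>j\<in>UNIV. s i j * ?r j\<bar> \<le> (\<Sum>j\<in>UNIV. s i j * (m j - a i)\<^sup>2)"
      by (rule order_trans[OF sum_abs], intro sum_mono)
        (auto simp: abs_mult s_def intro!: mult_left_mono arctan_second_order)
    moreover have "(\<Sum>j\<in>UNIV. s i j * (m j - a i)\<^sup>2) \<le> \<beta>"
    proof -
      have "norm (B *v (P $ i)) * norm (B *v (P $ i)) \<le> \<beta> * 1"
        using nB True \<beta>0 by (intro mult_mono) auto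
      thus ?thesis unfolding second by (simp add: dot_square_norm power2_eq_square)
    qed
    moreover have "\<bar>(\<Sum>j\<in>UNIV. s i j * (m j - a i)) / (1 + (a i)\<^sup>2)\<bar> \<le> \<beta>"
    proof -
      have "\<bar>P $ i \<bullet> (B *v (P $ i))\<bar> \<le> \<beta>"
        using Cauchy_Schwarz_ineq2[of "P $ i" "B *v (P $ i)"] nB nP[of i]
        by (simp add: norm_eq_1[symmetric])
      moreover have "\<bar>y / (1 + (a i)\<^sup>2)\<bar> \<le> \<bar>y\<bar>" for y
        by (simp add: abs_divide divide_le_eq mult_left_mono add_pos_nonneg)
          (simp add: algebra_simps)
      ultimately show ?thesis unfolding first using order_trans by blast
    qed
    ultimately show ?thesis by linarith
  qed
  \<comment> \<open>\<open>s2\<close> spreads each \<open>arctan (m j)\<close> over all i and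
    \<open>s1\<close> each \<open>arctan (a i)\<close> over all j, so both values become double sums
    with the same weights, and no pairing of the eigenvalues is needed.\<close>
  have "sum_arctan (A + B) = (\<Sum>j\<in>UNIV. (\<Sum>i\<in>UNIV. s i j) * arctan (m j))"
    by (simp add: s2 sum_arctan_diagonalized[OF Q m])
  also have "\<dots> = (\<Sum>i\<in>UNIV. \<Sum>j\<in>UNIV. s i j * arctan (m j))"
    by (simp add: sum_distrib_right) (rule sum.swap)
  finally have "sum_arctan (A + B) = (\<Sum>i\<in>UNIV. \<Sum>j\<in>UNIV. s i j * arctan (m j))" .
  moreover have "sum_arctan A = (\<Sum>i\<in>UNIV. (\<Sum>j\<in>UNIV. s i j) * arctan (a i))"
    by (simp add: s1 sum_arctan_diagonalized[OF P a])
  hence "sum_arctan A = (\<Sum>i\<in>UNIV. \<Sum>j\<in>UNIV. s i j * arctan (a i))"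
    by (simp add: sum_distrib_right)
  ultimately have "sum_arctan (A + B) - sum_arctan A
      = (\<Sum>i\<in>UNIV. \<Sum>j\<in>UNIV. s i j * (arctan (m j) - arctan (a i)))"
    by (simp add: algebra_simps flip: sum_subtractf)
  also have "\<bar>\<dots>\<bar> \<le> (\<Sum>i\<in>(UNIV :: 'n set). 2 * \<beta>)"
    by (rule order_trans[OF sum_abs], intro sum_mono row_bound)
  finally show ?thesis using \<beta>0 by simp
qed

section \<open>Test functions\<close>

lemma C21_with_add:
  assumes "C21_with \<phi> p g H" and "C21_with \<psi> q k G"
  shows "C21_with (\<lambda>z. \<phi> z + \<psi> z) (\<lambda>z. p z + q z) (\<lambda>z. g z + k z) (\<lambda>z. H z + G z)"
proof -
  have "((\<lambda>y. h y + h' y) has_derivative (\<lambda>v. (M + M') *v v)) (at x)"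
    if "(h has_derivative (\<lambda>v. M *v v)) (at x)" "(h' has_derivative (\<lambda>v. M' *v v)) (at x)"
    for h h' M M' and x :: "real^'a"
    using has_derivative_add[OF that] by (simp add: matrix_vector_mult_add_rdistrib)
  note der = this
  show ?thesis
    using assms unfolding C21_with_def
    by (auto intro!: continuous_on_add DERIV_add GDERIV_add der)
qed

lemma C21_with_cmult:
  assumes "C21_with \<phi> p g H"
  shows "C21_with (\<lambda>z. a * \<phi> z) (\<lambda>z. a * p z) (\<lambda>z. a *\<^sub>R g z) (\<lambda>z. a *\<^sub>R H z)"
proof -
  have 1: "GDERIV (\<lambda>y. a * h y) x :> a *\<^sub>R k" if "GDERIV h x :> k" for h k and x :: "real^'a"
    using that unfolding gderiv_def by (auto dest: has_derivative_mult_right[of _ _ _ a])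
  have 2: "((\<lambda>y. a *\<^sub>R h y) has_derivative (\<lambda>v. (a *\<^sub>R M) *v v)) (at x)"
    if "(h has_derivative (\<lambda>v. M *v v)) (at x)" for h M and x :: "real^'a"
    using has_derivative_scaleR_right[OF that, of a] by (simp add: scaleR_matrix_vector_assoc)
  show ?thesis
    using assms unfolding C21_with_def
    by (auto intro!: continuous_on_mult_left continuous_on_scaleR continuous_on_const DERIV_cmult 1 2)
qed

lemma C21_with_quad:
  fixes A :: "real^'n^'n"
  assumes sym: "transpose A = A"
  shows "C21_with (\<lambda>(x, t). quad \<tau> A b c x t) (\<lambda>_. \<tau>) (\<lambda>(x, t). A *v x + b) (\<lambda>_. A)"
proof -
  have cont: "continuous_on S (\<lambda>z. A *v fst z)" for S :: "((real^'n) \<times> real) set"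
    by (intro continuous_on_compose2[OF matrix_vector_mult_linear_continuous_on[of UNIV]]
        continuous_on_fst continuous_on_id) auto
  have lin: "((\<lambda>y. A *v y) has_derivative (\<lambda>h. A *v h)) (at x)" for x
    by (intro linear_imp_has_derivative matrix_vector_mul_linear)
  have sq: "((\<lambda>y. y \<bullet> (A *v y)) has_derivative (\<lambda>h. 2 * (h \<bullet> (A *v x)))) (at x)" for x
  proof -
    have "x \<bullet> (A *v h) + h \<bullet> (A *v x) = 2 * (h \<bullet> (A *v x))" for h
      using symmetric_dot[OF sym, of x h] by (simp add: inner_commute)
    thus ?thesis using has_derivative_inner[OF has_derivative_ident lin, of x] by simp
  qed
  have "((\<lambda>y. quad \<tau> A b c y t) has_derivative (\<lambda>h. h \<bullet> (A *v x + b))) (at x)" for x t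
  proof -
    have "((\<lambda>y. \<tau> * t + 1/2 * (y \<bullet> (A *v y)) + b \<bullet> y + c) has_derivative
        (\<lambda>h. 0 + 1/2 * (2 * (h \<bullet> (A *v x))) + b \<bullet> h + 0)) (at x)"
      by (intro has_derivative_add has_derivative_const has_derivative_mult_right sq
          has_derivative_inner_right has_derivative_ident)
    thus ?thesis by (simp add: quad_def inner_add_right inner_commute[of b])
  qed
  moreover have "((\<lambda>y. A *v y + b) has_derivative (\<lambda>h. A *v h)) (at x)" for x
    using has_derivative_add[OF lin has_derivative_const[of b]] by simp
  moreover have "((\<lambda>s. quad \<tau> A b c x s) has_real_derivative \<tau>) (at t within {..0})" for x t
    unfolding quad_def by (auto intro!: derivative_eq_intros)
  ultimately show ?thesis
    unfolding C21_with_def gderiv_def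
    by (auto simp: case_prod_unfold quad_def intro!: continuous_intros cont)
qed

section \<open>Powers of 1 + |x - y|^2\<close>

text \<open>One family serves every barrier: k = 1 centred at \<open>y\<close> for the local bound,
  k = 1 centred at 0 for growth at infinity, and k = - \<zeta> / 2 for decay. The summand 1 keeps it
  smooth at the centre.\<close>

definition bump :: "real^'n \<Rightarrow> real \<Rightarrow> real^'n \<Rightarrow> real" where
  "bump y k x = (1 + (x - y) \<bullet> (x - y)) powr k"

definition bump_hess :: "real^'n \<Rightarrow> real \<Rightarrow> real^'n \<Rightarrow> real^'n^'n" where
  "bump_hess y k x = (\<chi> i j. (if i = j then 2 * k else 0) * bump y (k - 1) x +
     4 * k * (k - 1) * bump y (k - 2) x * ((x - y) $ i * (x - y) $ j))"

lemma bump_arg_pos: "1 + (x - y) \<bullet> (x - y) > 0"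
  by (simp add: add_pos_nonneg)

lemma bump_pos: "bump y k x > 0"
  using bump_arg_pos[of x y] by (simp add: bump_def)

lemma continuous_on_bump [continuous_intros]:
  assumes "continuous_on S h"
  shows "continuous_on S (\<lambda>z. bump y k (h z))"
proof -
  have "1 + (x - y) \<bullet> (x - y) \<noteq> 0" for x
    using bump_arg_pos[of x y] by linarith
  thus ?thesis
    unfolding bump_def using assms by (intro continuous_intros) auto
qed

lemma has_derivative_bump:
  "(bump y k has_derivative (\<lambda>h. 2 * k * bump y (k - 1) x * ((x - y) \<bullet> h))) (at x)"
proof -
  have "((\<lambda>x. 1 + (x - y) \<bullet> (x - y)) has_derivative (\<lambda>h. 2 * ((x - y) \<bullet> h))) (at x)"
    by (auto intro!: derivative_eq_intros simp: inner_commute)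
  moreover have "((\<lambda>s. s powr k) has_real_derivative k * (1 + (x - y) \<bullet> (x - y)) powr (k - 1))
      (at (1 + (x - y) \<bullet> (x - y)))"
    by (rule has_real_derivative_powr[OF bump_arg_pos])
  ultimately have "((\<lambda>x. (1 + (x - y) \<bullet> (x - y)) powr k) has_derivative
      (\<lambda>h. (2 * ((x - y) \<bullet> h)) * (k * (1 + (x - y) \<bullet> (x - y)) powr (k - 1)))) (at x)"
    by (intro DERIV_compose_FDERIV)
  thus ?thesis
    unfolding bump_def by (simp add: mult_ac)
qed

lemma bump_hess_mult:
  "bump_hess y k x *v h = (2 * k * bump y (k - 1) x) *\<^sub>R h +
     (4 * k * (k - 1) * bump y (k - 2) x * ((x - y) \<bullet> h)) *\<^sub>R (x - y)"
  unfolding vec_eq_iff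
proof
  fix i
  have "(bump_hess y k x *v h) $ i = (\<Sum>j\<in>UNIV. (if i = j then 2 * k * bump y (k - 1) x * h $ j else 0) +
     4 * k * (k - 1) * bump y (k - 2) x * (x - y) $ i * ((x - y) $ j * h $ j))"
    unfolding bump_hess_def matrix_vector_mult_def vec_lambda_beta
    by (intro sum.cong refl) (simp add: algebra_simps)
  also have "\<dots> = 2 * k * bump y (k - 1) x * h $ i +
     4 * k * (k - 1) * bump y (k - 2) x * (x - y) $ i * ((x - y) \<bullet> h)"
    by (simp only: sum.distrib sum_distrib_left[symmetric] inner_vec_def inner_real_def) simp
  finally show "(bump_hess y k x *v h) $ i = ((2 * k * bump y (k - 1) x) *\<^sub>R h +
     (4 * k * (k - 1) * bump y (k - 2) x * ((x - y) \<bullet> h)) *\<^sub>R (x - y)) $ i"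
    by simp
qed

lemma transpose_bump_hess: "transpose (bump_hess y k x) = bump_hess y k x"
  by (simp add: transpose_def bump_hess_def vec_eq_iff mult.commute)

text \<open>With q = 1 + |x - y|^2 \<ge> 1, lowering the exponent only decreases the power, and |x -
  y|^2 \<le> q absorbs the rank-one part. That the bound is linear in \<open>bump y k x\<close> lets
  exponential growth in time outweigh it.\<close>

lemma norm_bump_hess_le:
  "norm (bump_hess y k x *v h) \<le> (2 * \<bar>k\<bar> + 4 * \<bar>k * (k - 1)\<bar>) * bump y k x * norm h"
proof -
  define q where "q = 1 + (x - y) \<bullet> (x - y)"
  have q: "q \<ge> 1" "(norm (x - y))\<^sup>2 \<le> q" by (auto simp: q_def power2_norm_eq_inner)
  have b1: "bump y (k - 1) x \<le> bump y k x"
    using q by (simp add: bump_def q_def[symmetric] powr_mono)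
  have "bump y (k - 2) x * (norm (x - y))\<^sup>2 \<le> bump y (k - 2) x * q"
    using bump_pos[of y "k - 2" x] q by (intro mult_left_mono) auto
  also have "\<dots> = bump y (k - 1) x"
    using q powr_add[of q "k - 2" 1] by (simp add: bump_def q_def[symmetric])
  finally have b2: "bump y (k - 2) x * (norm (x - y))\<^sup>2 \<le> bump y k x" using b1 by linarith
  have "norm (bump_hess y k x *v h) \<le> norm ((2 * k * bump y (k - 1) x) *\<^sub>R h) +
      norm ((4 * k * (k - 1) * bump y (k - 2) x * ((x - y) \<bullet> h)) *\<^sub>R (x - y))"
    unfolding bump_hess_mult by (rule norm_triangle_ineq)
  also have "norm ((2 * k * bump y (k - 1) x) *\<^sub>R h) = 2 * \<bar>k\<bar> * bump y (k - 1) x * norm h"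
    using bump_pos[of y "k - 1" x] by (simp add: abs_mult)
  also have "\<dots> \<le> 2 * \<bar>k\<bar> * bump y k x * norm h"
    using b1 by (intro mult_right_mono mult_left_mono) auto
  also have "norm ((4 * k * (k - 1) * bump y (k - 2) x * ((x - y) \<bullet> h)) *\<^sub>R (x - y)) =
      (4 * \<bar>k * (k - 1)\<bar> * bump y (k - 2) x * norm (x - y)) * \<bar>(x - y) \<bullet> h\<bar>"
    by (simp only: norm_scaleR abs_mult abs_numeral abs_of_pos[OF bump_pos] mult_ac)
  also have "\<dots> \<le> (4 * \<bar>k * (k - 1)\<bar> * bump y (k - 2) x * norm (x - y)) * (norm (x - y) * norm h)"
    using bump_pos[of y "k - 2" x]
    by (intro mult_left_mono Cauchy_Schwarz_ineq2) auto
  also have "\<dots> = 4 * \<bar>k * (k - 1)\<bar> * (bump y (k - 2) x * (norm (x - y))\<^sup>2) * norm h"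
    by (simp only: power2_eq_square mult_ac)
  also have "\<dots> \<le> 4 * \<bar>k * (k - 1)\<bar> * bump y k x * norm h"
    using b2 by (intro mult_right_mono mult_left_mono) auto
  finally show ?thesis by (simp add: algebra_simps)
qed

lemma C21_with_exp_bump:
  fixes y :: "real^'n"
  shows "C21_with (\<lambda>(x, t). exp (l * t) * bump y k x) (\<lambda>(x, t). l * (exp (l * t) * bump y k x))
    (\<lambda>(x, t). (exp (l * t) * (2 * k * bump y (k - 1) x)) *\<^sub>R (x - y))
    (\<lambda>(x, t). exp (l * t) *\<^sub>R bump_hess y k x)"
proof -
  have "GDERIV (\<lambda>x. exp (l * t) * bump y k x) x :> (exp (l * t) * (2 * k * bump y (k - 1) x)) *\<^sub>R (x - y)"
    for x t
    unfolding gderiv_def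
    using has_derivative_mult_right[OF has_derivative_bump[of y k x], of "exp (l * t)"]
    by (simp add: inner_commute mult_ac)
  moreover have "((\<lambda>x. (exp (l * t) * (2 * k * bump y (k - 1) x)) *\<^sub>R (x - y)) has_derivative
      (\<lambda>h. (exp (l * t) *\<^sub>R bump_hess y k x) *v h)) (at x)" for x t
    by (auto intro!: derivative_eq_intros has_derivative_bump
        simp: fun_eq_iff bump_hess_mult algebra_simps scaleR_matrix_vector_assoc[symmetric])
  moreover have "((\<lambda>t. exp (l * t) * bump y k x) has_real_derivative
      l * (exp (l * t) * bump y k x)) (at t within {..0})" for x t
    by (auto intro!: derivative_eq_intros)
  moreover have "continuous_on S (\<lambda>z. bump_hess y k (fst z))" for S :: "((real^'n) \<times> real) set"
    unfolding bump_hess_def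
    by (intro continuous_intros)
  ultimately show ?thesis
    unfolding C21_with_def by (auto simp: case_prod_unfold intro!: continuous_intros)
qed

section \<open>Extension of test functions beyond their final time\<close>

text \<open>The expression is \<open>G s\<close> for s \<le> 0 and \<open>2 * G 0 - G (- s)\<close>
  for s \<ge> 0, so both one-sided derivatives at 0 are \<open>P 0\<close>. The cut-offs by
  \<open>min\<close> evaluate \<open>G\<close> only at times \<le> 0.\<close>

lemma has_real_derivative_odd_reflection:
  fixes G P :: "real \<Rightarrow> real"
  assumes G: "\<And>r. r \<le> 0 \<Longrightarrow> (G has_real_derivative P r) (at r within {..0})"
  shows "((\<lambda>s. G (min s 0) + G 0 - G (min (- s) 0)) has_real_derivative P (- \<bar>s\<bar>)) (at s)"
    (is "(?h has_real_derivative _) _")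
proof -
  have left: "(?h has_real_derivative P s) (at s within {..0})" if "s \<le> 0" for s
    by (rule has_field_derivative_transform_within[OF G[OF that] zero_less_one]) (use that in auto)
  have right: "(?h has_real_derivative P (- s)) (at s within {0..})" if "s \<ge> 0" for s
  proof -
    have "(G has_real_derivative P (- s)) (at (- s) within uminus ` {0..})"
      using G[of "- s"] that by simp
    hence "(G \<circ> uminus has_real_derivative P (- s) * - 1) (at s within {0..})"
      by (rule DERIV_image_chain) (auto intro!: derivative_eq_intros)
    hence "((\<lambda>s. 2 * G 0 - G (- s)) has_real_derivative P (- s)) (at s within {0..})"
      by (auto intro!: derivative_eq_intros simp: comp_def)
    thus ?thesis
      by (rule has_field_derivative_transform_within[OF _ zero_less_one]) (use that in auto)
  qed
  show ?thesis
  proof (cases s "0 :: real" rule: linorder_cases)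
    case less
    hence "at s within {..0} = at s" by (intro at_within_interior) auto
    thus ?thesis using left[of s] less by simp
  next
    case greater
    hence "at s within {0..} = at s" by (intro at_within_interior) auto
    thus ?thesis using right[of s] greater by simp
  next
    case equal
    have "(at 0 :: real filter) = sup (at 0 within {..0}) (at 0 within {0..})"
    proof -
      have "{..0} \<union> {0..} = (UNIV :: real set)" by auto
      thus ?thesis by (metis at_within_union)
    qed
    hence "(?h has_real_derivative P 0) (at 0)"
      using left[of 0] right[of 0] unfolding has_field_derivative_iff by (simp add: filterlim_sup)
    thus ?thesis using equal by simp
  qed
qed

text \<open>A test function for the solution translated in time is only defined up to the time \<open>- T\<close> of
  the original solution; odd reflection in time extends it to a test function on \<open>Rminus\<close>.\<close>

lemma C21_with_time_shift:
  fixes \<phi> :: "(real^'n) \<times> real \<Rightarrow> real"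
  assumes C21: "C21_with \<phi> p g H" and "T \<ge> 0"
  obtains \<phi>' p' g' H' where "C21_with \<phi>' p' g' H'"
    "\<And>x t. t \<le> 0 \<Longrightarrow> \<phi>' (x, t - T) = \<phi> (x, t)"
    "\<And>x t. t \<le> 0 \<Longrightarrow> p' (x, t - T) = p (x, t)"
    "\<And>x t. t \<le> 0 \<Longrightarrow> H' (x, t - T) = H (x, t)"
proof
  \<comment> \<open>All three maps land in \<open>Rminus\<close> and leave x alone, so gradient and
    Hessian are the same combination of compositions as the function itself. For t \<le> - T the
    terms from \<open>?z\<close> and \<open>?r'\<close> cancel.\<close>
  let ?r = "\<lambda>(x :: real^'n, t). (x, min (t + T) 0)"
  let ?r' = "\<lambda>(x :: real^'n, t). (x, min (- t - T) 0)"
  let ?z = "\<lambda>(x :: real^'n, t :: real). (x, 0 :: real)"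
  have cont: "continuous_on Rminus (\<lambda>w. F (?r w))" "continuous_on Rminus (\<lambda>w. F (?r' w))"
    "continuous_on Rminus (\<lambda>w. F (?z w))" "continuous_on Rminus (\<lambda>(x, t). F (x, - \<bar>t + T\<bar>))"
    if "continuous_on Rminus F" for F :: "(real^'n) \<times> real \<Rightarrow> 'b::topological_space"
    by (auto simp: case_prod_unfold Rminus_def
        intro!: continuous_on_compose2[OF that] continuous_intros)
  have x0: "(x, 0) \<in> Rminus" for x :: "real^'n" by (simp add: Rminus_def)
  have mm: "(x, min s 0) \<in> Rminus" for x :: "real^'n" and s by (simp add: Rminus_def)
  have time: "((\<lambda>t. \<phi> (x, min (t + T) 0) + \<phi> (x, 0) - \<phi> (x, min (- t - T) 0)) has_real_derivative
      p (x, - \<bar>t + T\<bar>)) (at t within {..0})" for x t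
  proof -
    have "((\<lambda>s. \<phi> (x, min s 0) + \<phi> (x, 0) - \<phi> (x, min (- s) 0)) has_real_derivative
      p (x, - \<bar>t + T\<bar>)) (at (t + T))"
      by (rule has_real_derivative_odd_reflection[of "\<lambda>s. \<phi> (x, s)" "\<lambda>s. p (x, s)"])
        (use C21 in \<open>auto simp: C21_with_def Rminus_def\<close>)
    moreover have "- (s + T) = - s - T" for s by simp
    ultimately show ?thesis
      unfolding DERIV_shift by (simp only: has_field_derivative_at_within)
  qed
  have space: "GDERIV (\<lambda>y. \<phi> (y, t)) x :> g (x, t)"
    "((\<lambda>y. g (y, t)) has_derivative (\<lambda>h. H (x, t) *v h)) (at x)" if "(x, t) \<in> Rminus" for x t
    using C21 that unfolding C21_with_def by blast+
  show "C21_with (\<lambda>w. \<phi> (?r w) + \<phi> (?z w) - \<phi> (?r' w)) (\<lambda>(x, t). p (x, - \<bar>t + T\<bar>))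
     (\<lambda>w. g (?r w) + g (?z w) - g (?r' w)) (\<lambda>w. H (?r w) + H (?z w) - H (?r' w))"
    unfolding C21_with_def
  proof (intro conjI allI impI)
    fix x :: "real^'n" and t :: real
    show "((\<lambda>s. \<phi> (?r (x, s)) + \<phi> (?z (x, s)) - \<phi> (?r' (x, s))) has_real_derivative
        (case (x, t) of (x, t) \<Rightarrow> p (x, - \<bar>t + T\<bar>))) (at t within {..0})"
      using time by simp
    show "GDERIV (\<lambda>y. \<phi> (?r (y, t)) + \<phi> (?z (y, t)) - \<phi> (?r' (y, t))) x
        :> g (?r (x, t)) + g (?z (x, t)) - g (?r' (x, t))"
      by (auto intro!: GDERIV_add GDERIV_diff space mm x0)
    show "((\<lambda>y. g (?r (y, t)) + g (?z (y, t)) - g (?r' (y, t))) has_derivative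
        (\<lambda>h. (H (?r (x, t)) + H (?z (x, t)) - H (?r' (x, t))) *v h)) (at x)"
      unfolding matrix_vector_mult_add_rdistrib matrix_vector_mult_diff_rdistrib
      by (auto intro!: has_derivative_add has_derivative_diff space mm x0)
  qed (use C21 in \<open>auto simp: C21_with_def intro!: continuous_on_add continuous_on_diff cont\<close>)
qed auto

section \<open>Comparison and decay\<close>

text \<open>The sign \<open>\<sigma> = 1\<close> gives the subsolution property, and \<open>\<sigma> = - 1\<close> the supersolution property.\<close>

definition signed_subsolution ::
  "real \<Rightarrow> ((real^'n) \<times> real \<Rightarrow> real) \<Rightarrow> ((real^'n) \<times> real \<Rightarrow> real) \<Rightarrow> bool" where
  "signed_subsolution \<sigma> f u \<longleftrightarrow> continuous_on Rminus u \<and>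
     (\<forall>\<phi> p g H x0 t0. C21_with \<phi> p g H \<longrightarrow> (x0, t0) \<in> Rminus \<longrightarrow>
        local_max_at (\<lambda>z. \<sigma> * (u z - \<phi> z)) x0 t0 \<longrightarrow>
        \<sigma> * p (x0, t0) \<le> \<sigma> * (sum_arctan (H (x0, t0)) + f (x0, t0)))"

lemma viscosity_solution_iff_signed:
  "viscosity_solution f u \<longleftrightarrow> signed_subsolution 1 f u \<and> signed_subsolution (- 1) f u"
proof -
  have "local_max_at (\<lambda>z. - 1 * (u z - \<phi> z)) x t \<longleftrightarrow> local_min_at (\<lambda>z. u z - \<phi> z) x t" for \<phi> x t
    by (simp only: local_max_at_def local_min_at_def mult_minus1 neg_le_iff_le)
  hence "signed_subsolution (- 1) f u \<longleftrightarrow> viscosity_supersolution f u"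
    unfolding signed_subsolution_def viscosity_supersolution_def C0_minus_def
    by (simp only: mult_minus1 neg_le_iff_le mem_Collect_eq imp_conjL)
  moreover have "signed_subsolution 1 f u \<longleftrightarrow> viscosity_subsolution f u"
    unfolding signed_subsolution_def viscosity_subsolution_def C0_minus_def
    by (simp only: mult_1 mem_Collect_eq imp_conjL)
  ultimately show ?thesis by (simp add: viscosity_solution_def)
qed

text \<open>A positive maximum of \<sigma> (u - \<phi>) over the closed cylinder avoids its bottom
  and its lateral wall. Since local maxima are taken backwards in time, a maximum at t = 0 is also
  admissible, and testing with \<phi> contradicts the strict inequality.\<close>

lemma cylinder_comparison:
  fixes u \<phi> :: "(real^'n) \<times> real \<Rightarrow> real"
  assumes sub: "signed_subsolution \<sigma> f u" and C21: "C21_with \<phi> p g H"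
    and init: "\<And>x. norm (x - y) \<le> \<rho> \<Longrightarrow> \<sigma> * (u (x, - T) - \<phi> (x, - T)) \<le> 0"
    and lateral: "\<And>x t. \<lbrakk>norm (x - y) = \<rho>; - T \<le> t; t \<le> 0\<rbrakk> \<Longrightarrow> \<sigma> * (u (x, t) - \<phi> (x, t)) \<le> 0"
    and strict: "\<And>x t. \<lbrakk>norm (x - y) < \<rho>; - T < t; t \<le> 0\<rbrakk> \<Longrightarrow>
      \<sigma> * (sum_arctan (H (x, t)) + f (x, t)) < \<sigma> * p (x, t)"
    and x: "norm (x - y) \<le> \<rho>" "- T \<le> t" "t \<le> 0"
  shows "\<sigma> * (u (x, t) - \<phi> (x, t)) \<le> 0"
proof (rule ccontr)
  assume pos: "\<not> \<sigma> * (u (x, t) - \<phi> (x, t)) \<le> 0"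
  define w where "w z = \<sigma> * (u z - \<phi> z)" for z
  define W where "W = cball y \<rho> \<times> {- T..0}"
  have inW: "(x, t) \<in> W \<longleftrightarrow> norm (x - y) \<le> \<rho> \<and> - T \<le> t \<and> t \<le> 0" for x t
    by (auto simp: W_def dist_norm norm_minus_commute)
  have "compact W" unfolding W_def by (intro compact_Times compact_cball compact_Icc)
  moreover have "W \<noteq> {}" using x inW by blast
  moreover have "W \<subseteq> Rminus" by (auto simp: W_def Rminus_def)
  hence "continuous_on W w"
    using sub C21 unfolding w_def signed_subsolution_def C21_with_def
    by (auto intro!: continuous_intros intro: continuous_on_subset)
  ultimately obtain z where z: "z \<in> W" "\<And>z'. z' \<in> W \<Longrightarrow> w z' \<le> w z"
    using continuous_attains_sup[of W w] by auto
  obtain x0 t0 where zz: "z = (x0, t0)" by (cases z)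
  have wpos: "w (x0, t0) > 0" using z(2)[of "(x, t)"] pos x zz by (auto simp: inW w_def)
  have z0: "norm (x0 - y) \<le> \<rho>" "- T \<le> t0" "t0 \<le> 0" using z zz by (auto simp: inW)
  have "t0 \<noteq> - T" using init[of x0] z0 wpos by (auto simp: w_def)
  moreover have "norm (x0 - y) \<noteq> \<rho>" using lateral[of x0 t0] z0 wpos by (auto simp: w_def)
  ultimately have z1: "norm (x0 - y) < \<rho>" "- T < t0" using z0 by auto
  have "local_max_at w x0 t0"
    unfolding local_max_at_def
  proof (intro exI conjI ballI)
    \<comment> \<open>The parabolic cylinder of this radius stays inside \<open>W\<close>: its time
      depth r^2 is at most t0 + T.\<close>
    define r where "r = min (\<rho> - norm (x0 - y)) (sqrt (t0 + T))"
    show "r > 0" using z1 by (simp add: r_def)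
    have "r\<^sup>2 \<le> (sqrt (t0 + T))\<^sup>2" using \<open>r > 0\<close> by (intro power_mono) (auto simp: r_def)
    hence r2: "r\<^sup>2 \<le> t0 + T" using z1 by simp
    fix z' assume "z' \<in> parabolic_cylinder x0 t0 r"
    then obtain x' t' where z': "z' = (x', t')" "norm (x' - x0) < r" "t0 - r\<^sup>2 < t'" "t' \<le> t0"
      by (auto simp: parabolic_cylinder_def)
    have "norm (x' - y) \<le> norm (x' - x0) + norm (x0 - y)"
      using norm_triangle_ineq[of "x' - x0" "x0 - y"] by simp
    hence "z' \<in> W" using z' z0 r2 by (auto simp: inW r_def)
    thus "w z' \<le> w (x0, t0)" using z(2) zz by simp
  qed
  moreover have "(x0, t0) \<in> Rminus" using z0 by (simp add: Rminus_def)
  ultimately have "\<sigma> * p (x0, t0) \<le> \<sigma> * (sum_arctan (H (x0, t0)) + f (x0, t0))"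
    using sub C21 unfolding signed_subsolution_def w_def by blast
  thus False using strict[OF z1 z0(3)] by simp
qed

text \<open>The operator is bounded, so the time derivative of the solution is bounded in the viscosity
  sense. Hence no growth condition at infinity is needed.\<close>

lemma deviation_bounded:
  fixes u f :: "(real^'n) \<times> real \<Rightarrow> real"
  assumes sub: "signed_subsolution \<sigma> f u" and \<sigma>: "\<sigma> \<in> {1, - 1}" and A: "transpose A = A"
    and f: "\<And>x t. t \<le> 0 \<Longrightarrow> \<bar>f (x, t)\<bar> \<le> S"
    and init: "\<And>x. u (x, - T) = quad \<tau> A b c x (- T)"
    and t: "- T \<le> t" "t \<le> 0"
  shows "\<sigma> * (u (y, t) - quad \<tau> A b c y t) \<le> (\<bar>\<tau>\<bar> + 2 * CARD('n) + S + 1) * T"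
proof -
  \<comment> \<open>A slope in time exceeding |\<tau>|, the operator bound and |f| together, with 1
    to spare for strictness.\<close>
  define K where "K = \<bar>\<tau>\<bar> + 2 * CARD('n) + S + 1"
  have "S \<ge> 0" using f[of 0 0] by simp
  hence K0: "K \<ge> 0" by (simp add: K_def)
  have \<sigma>2: "\<sigma> * \<sigma> = 1" "\<bar>\<sigma>\<bar> = 1" using \<sigma> by auto
  define W where "W = cball y 1 \<times> {- T..0}"
  have "compact W" unfolding W_def by (intro compact_Times compact_cball compact_Icc)
  moreover have "continuous_on W (\<lambda>z. u z - quad \<tau> A b c (fst z) (snd z))"
  proof (intro continuous_on_diff)
    have "W \<subseteq> Rminus" by (auto simp: W_def Rminus_def)
    moreover have "continuous_on Rminus (\<lambda>(x, t). quad \<tau> A b c x t)"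
      using C21_with_quad[OF A] unfolding C21_with_def by blast
    ultimately show "continuous_on W u" "continuous_on W (\<lambda>z. quad \<tau> A b c (fst z) (snd z))"
      using sub continuous_on_subset by (auto simp: signed_subsolution_def case_prod_unfold)
  qed
  ultimately have "bounded ((\<lambda>z. u z - quad \<tau> A b c (fst z) (snd z)) ` W)"
    by (intro compact_imp_bounded compact_continuous_image)
  \<comment> \<open>\<open>N\<close> may depend badly on \<open>y\<close>, but it enters only as N
    |x - y|^2, which vanishes at the centre; the final bound is therefore uniform in
    \<open>y\<close>.\<close>
  then obtain N where N: "\<And>z. z \<in> W \<Longrightarrow> \<bar>u z - quad \<tau> A b c (fst z) (snd z)\<bar> \<le> N"
    unfolding bounded_iff by auto
  have "(y, 0) \<in> W" using t by (simp add: W_def)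
  hence N0: "N \<ge> 0" using N[of "(y, 0)"] by (meson abs_ge_zero order_trans)
  \<comment> \<open>This is the quadratic plus \<sigma> (K (t + T) + N |x - y|^2): the
    \<open>- N\<close> in the constant cancels the summand 1 of \<open>bump y 1\<close>, and
    \<open>exp (0 * t)\<close> makes the time-dependent barrier stationary.\<close>
  define \<phi> where "\<phi> = (\<lambda>z. (\<lambda>(x, t). quad (\<tau> + \<sigma> * K) A b (c + \<sigma> * (K * T - N)) x t) z +
    (\<sigma> * N) * (\<lambda>(x, t). exp (0 * t) * bump y 1 x) z)"
  have bump1: "bump y 1 x = 1 + (norm (x - y))\<^sup>2" for x
    using bump_arg_pos[of x y] by (simp add: bump_def power2_norm_eq_inner)
  have \<phi>: "\<sigma> * (u (x, t) - \<phi> (x, t)) =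
      \<sigma> * (u (x, t) - quad \<tau> A b c x t) - K * (t + T) - N * (norm (x - y))\<^sup>2" for x t
  proof -
    have "\<phi> (x, t) = quad \<tau> A b c x t + \<sigma> * (K * (t + T) + N * (norm (x - y))\<^sup>2)"
      by (simp add: \<phi>_def quad_def bump1 algebra_simps)
    hence "\<sigma> * (u (x, t) - \<phi> (x, t)) = \<sigma> * (u (x, t) - quad \<tau> A b c x t) -
        (\<sigma> * \<sigma>) * (K * (t + T) + N * (norm (x - y))\<^sup>2)"
      by (simp add: algebra_simps)
    thus ?thesis by (simp add: \<sigma>2)
  qed
  have "\<sigma> * (u (y, t) - \<phi> (y, t)) \<le> 0"
  proof (rule cylinder_comparison[OF sub, of \<phi> _ _ _ y 1 T])
    show "C21_with \<phi>
      (\<lambda>z. (\<tau> + \<sigma> * K) + (\<sigma> * N) * (\<lambda>(x, t). 0 * (exp (0 * t) * bump y 1 x)) z)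
      (\<lambda>z. (\<lambda>(x, t). A *v x + b) z + (\<sigma> * N) *\<^sub>R (\<lambda>(x, t). (exp (0 * t) * (2 * 1 * bump y (1 - 1) x)) *\<^sub>R (x - y)) z)
      (\<lambda>z. A + (\<sigma> * N) *\<^sub>R (\<lambda>(x, t). exp (0 * t) *\<^sub>R bump_hess y 1 x) z)"
      unfolding \<phi>_def by (intro C21_with_add C21_with_cmult C21_with_quad C21_with_exp_bump A)
    show "\<sigma> * (u (x, - T) - \<phi> (x, - T)) \<le> 0" for x
      unfolding \<phi> using N0 init by simp
    show "\<sigma> * (u (x, s) - \<phi> (x, s)) \<le> 0" if "norm (x - y) = 1" "- T \<le> s" "s \<le> 0" for x s
    proof -
      have "(x, s) \<in> W" using that by (simp add: W_def dist_norm norm_minus_commute)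
      from N[OF this] have "\<bar>\<sigma> * (u (x, s) - quad \<tau> A b c x s)\<bar> \<le> N" by (simp add: abs_mult \<sigma>2)
      moreover have "0 \<le> K * (s + T)" using K0 that by simp
      ultimately show ?thesis unfolding \<phi> that(1) by simp
    qed
    fix x s assume s: "norm (x - y) < 1" "- T < s" "s \<le> 0"
    let ?M = "A + (\<sigma> * N) *\<^sub>R (\<lambda>(x, t). exp (0 * t) *\<^sub>R bump_hess y 1 x) (x, s)"
    \<comment> \<open>However large \<open>N\<close> makes the Hessian, the operator stays within
      its universal bound.\<close>
    have "\<sigma> * (sum_arctan ?M + f (x, s)) \<le> \<bar>sum_arctan ?M\<bar> + \<bar>f (x, s)\<bar>"
      using \<sigma> by auto
    also have "\<dots> < K - \<bar>\<tau>\<bar>"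
      using sum_arctan_bound[of ?M] f[OF s(3), of x] by (simp add: K_def)
    also have "\<dots> \<le> \<sigma> * \<tau> + \<sigma> * \<sigma> * K" using \<sigma> by auto
    finally show "\<sigma> * (sum_arctan ?M + f (x, s)) < \<sigma> *
        ((\<tau> + \<sigma> * K) + (\<sigma> * N) * (\<lambda>(x, t). 0 * (exp (0 * t) * bump y 1 x)) (x, s))"
      by (simp add: algebra_simps)
  qed (use t in auto)
  hence "\<sigma> * (u (y, t) - quad \<tau> A b c y t) \<le> K * (t + T)" unfolding \<phi> by simp
  also have "\<dots> \<le> K * T" using K0 t by (intro mult_left_mono) auto
  finally show ?thesis by (simp add: K_def)
qed

text \<open>The barrier: since the second derivatives of \<open>bump 0 k\<close> are bounded by a multiple of
  \<open>bump 0 k\<close> itself, multiplying by \<open>exp (l * t)\<close> with \<open>l\<close> large makes it a supersolution of the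
  equation for the deviation. The small multiple of \<open>bump 0 1\<close> dominates the bounded deviation
  near infinity and is removed in the end.\<close>

lemma deviation_decay:
  fixes u f :: "(real^'n) \<times> real \<Rightarrow> real"
  assumes sub: "signed_subsolution \<sigma> f u" and \<sigma>: "\<sigma> \<in> {1, - 1}" and A: "transpose A = A"
    and \<tau>: "\<tau> = sum_arctan A"
    and f: "\<And>x t. t \<le> 0 \<Longrightarrow> \<bar>f (x, t)\<bar> \<le> S"
    and f0: "\<And>x t. t \<le> 0 \<Longrightarrow> norm x > R \<Longrightarrow> f (x, t) = 0"
    and init: "\<And>x. u (x, - T) = quad \<tau> A b c x (- T)"
    and T: "T \<ge> 0" and \<zeta>: "\<zeta> > 0"
  shows "\<exists>C>0. \<forall>x t. x \<noteq> 0 \<and> - T < t \<and> t \<le> 0 \<longrightarrow>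
           \<sigma> * (u (x, t) - quad \<tau> A b c x t) \<le> C * norm x powr (- \<zeta>)"
proof -
  define L where "L k = 2 * \<bar>k\<bar> + 4 * \<bar>k * (k - 1)\<bar>" for k :: real
  define k where "k = - \<zeta> / 2"
  have k: "k < 0" using \<zeta> by (simp add: k_def)
  \<comment> \<open>The first summand pays for the change of the operator caused by the barrier's
    Hessian, the extra 1 for \<open>f\<close>.\<close>
  define l where "l = 4 * CARD('n) * (L k + L 1) + 1"
  have L0: "L j \<ge> 0" for j by (simp add: L_def)
  have l0: "l \<ge> 1" using L0[of k] L0[of 1] by (simp add: l_def)
  have S0: "S \<ge> 0" using f[of 0 0] by simp
  \<comment> \<open>Chosen so that the decaying barrier is at least S + 1 where |x| \<le> R, even at
    time - T, where \<open>exp (l * t)\<close> is smallest.\<close>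
  define K where "K = (S + 1) * exp (l * T) * (1 + R\<^sup>2) powr (- k)"
  have "1 + R\<^sup>2 > 0" by (simp add: add_pos_nonneg)
  hence K0: "K > 0" using S0 by (simp add: K_def)
  define M where "M = (\<bar>\<tau>\<bar> + 2 * CARD('n) + S + 1) * T"
  have M0: "M \<ge> 0" using S0 T by (simp add: M_def)
  have bound: "\<sigma> * (u (x, t) - quad \<tau> A b c x t) \<le> M" if "- T \<le> t" "t \<le> 0" for x t
    unfolding M_def by (rule deviation_bounded[OF sub \<sigma> A f init that])
  have \<sigma>2: "\<sigma> * \<sigma> = 1" "\<bar>\<sigma>\<bar> = 1" using \<sigma> by auto
  have bump1: "bump 0 1 x = 1 + (norm x)\<^sup>2" for x :: "real^'n"
    using bump_arg_pos[of x 0] by (simp add: bump_def power2_norm_eq_inner)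
  have f_le: "\<bar>f (x, t)\<bar> \<le> K * (exp (l * t) * bump 0 k x)" if "- T \<le> t" "t \<le> 0" for x t
  proof (cases "norm x > R")
    case True
    have "0 \<le> K * (exp (l * t) * bump 0 k x)"
      using K0 bump_pos[of 0 k x] by simp
    then show ?thesis using f0[OF that(2) True] by simp
  next
    case False
    have "1 + x \<bullet> x \<le> 1 + R\<^sup>2"
      using False by (simp add: power2_norm_eq_inner[symmetric] power_mono)
    hence "(1 + R\<^sup>2) powr k \<le> bump 0 k x"
      using k bump_arg_pos[of x 0] unfolding bump_def by (intro powr_mono2') auto
    moreover have "exp (- (l * T)) \<le> exp (l * t)" using that l0 mult_left_mono[of "- T" t l] by simp
    ultimately have "exp (- (l * T)) * (1 + R\<^sup>2) powr k \<le> exp (l * t) * bump 0 k x"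
      by (intro mult_mono) auto
    hence "K * (exp (- (l * T)) * (1 + R\<^sup>2) powr k) \<le> K * (exp (l * t) * bump 0 k x)"
      using K0 by (intro mult_left_mono) auto
    moreover have "K * (exp (- (l * T)) * (1 + R\<^sup>2) powr k) = S + 1"
      using \<open>1 + R\<^sup>2 > 0\<close> by (simp add: K_def exp_minus powr_minus field_simps)
    ultimately show ?thesis using f[OF that(2), of x] by simp
  qed
  have main: "\<sigma> * (u (x, t) - quad \<tau> A b c x t) \<le> K * bump 0 k x + \<delta> * bump 0 1 x"
    if t: "- T \<le> t" "t \<le> 0" and \<delta>: "\<delta> > 0" for x t \<delta>
  proof -
    let ?B = "\<lambda>x t. K * (exp (l * t) * bump 0 k x) + \<delta> * (exp (l * t) * bump 0 1 x)"
    \<comment> \<open>Large enough to contain \<open>x\<close> and to make the \<delta>-term exceed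
      the bound \<open>M\<close> on the lateral wall at all times in the strip.\<close>
    define \<rho> where "\<rho> = norm x + sqrt (M * exp (l * T) / \<delta>)"
    have \<rho>: "norm x \<le> \<rho>" "M * exp (l * T) / \<delta> \<le> \<rho>\<^sup>2"
    proof -
      have "sqrt (M * exp (l * T) / \<delta>) \<ge> 0" using M0 \<delta> by simp
      thus "norm x \<le> \<rho>" by (simp add: \<rho>_def)
      have "(sqrt (M * exp (l * T) / \<delta>))\<^sup>2 \<le> \<rho>\<^sup>2"
        using M0 \<delta> by (intro power_mono) (auto simp: \<rho>_def)
      thus "M * exp (l * T) / \<delta> \<le> \<rho>\<^sup>2" using M0 \<delta> by simp
    qed
    define \<phi> where "\<phi> = (\<lambda>z. (\<lambda>(x, t). quad \<tau> A b c x t) z +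
      ((\<sigma> * K) * (\<lambda>(x, t). exp (l * t) * bump 0 k x) z +
       (\<sigma> * \<delta>) * (\<lambda>(x, t). exp (l * t) * bump 0 1 x) z))"
    have \<phi>: "\<sigma> * (u (x, t) - \<phi> (x, t)) = \<sigma> * (u (x, t) - quad \<tau> A b c x t) - ?B x t" for x t
    proof -
      have "\<sigma> * (u (x, t) - \<phi> (x, t)) = \<sigma> * (u (x, t) - quad \<tau> A b c x t) - (\<sigma> * \<sigma>) * ?B x t"
        by (simp add: \<phi>_def algebra_simps)
      thus ?thesis by (simp only: \<sigma>2) simp
    qed
    have B0: "?B x t \<ge> 0" for x t
      using K0 \<delta> bump_pos[of 0 k x] bump_pos[of 0 1 x] by (intro add_nonneg_nonneg mult_nonneg_nonneg) auto
    have "\<sigma> * (u (x, t) - \<phi> (x, t)) \<le> 0"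
    proof (rule cylinder_comparison[OF sub, of \<phi> _ _ _ 0 \<rho> T])
      show "C21_with \<phi>
        (\<lambda>z. \<tau> + ((\<sigma> * K) * (\<lambda>(x, t). l * (exp (l * t) * bump 0 k x)) z +
          (\<sigma> * \<delta>) * (\<lambda>(x, t). l * (exp (l * t) * bump 0 1 x)) z))
        (\<lambda>z. (\<lambda>(x, t). A *v x + b) z +
          ((\<sigma> * K) *\<^sub>R (\<lambda>(x, t). (exp (l * t) * (2 * k * bump 0 (k - 1) x)) *\<^sub>R (x - 0)) z +
           (\<sigma> * \<delta>) *\<^sub>R (\<lambda>(x, t). (exp (l * t) * (2 * 1 * bump 0 (1 - 1) x)) *\<^sub>R (x - 0)) z))
        (\<lambda>z. A + ((\<sigma> * K) *\<^sub>R (\<lambda>(x, t). exp (l * t) *\<^sub>R bump_hess 0 k x) z +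
           (\<sigma> * \<delta>) *\<^sub>R (\<lambda>(x, t). exp (l * t) *\<^sub>R bump_hess 0 1 x) z))"
        unfolding \<phi>_def by (intro C21_with_add C21_with_cmult C21_with_quad C21_with_exp_bump A)
      show "\<sigma> * (u (x, - T) - \<phi> (x, - T)) \<le> 0" for x
        unfolding \<phi> using B0[of "- T" x] init by simp
      show "\<sigma> * (u (x, s) - \<phi> (x, s)) \<le> 0" if "norm (x - 0) = \<rho>" "- T \<le> s" "s \<le> 0" for x s
      proof -
        have "exp (- (l * T)) \<le> exp (l * s)" using that l0 mult_left_mono[of "- T" s l] by simp
        have "M = \<delta> * (exp (- (l * T)) * (M * exp (l * T) / \<delta>))"
          using \<delta> by (simp add: exp_minus field_simps)
        also have "\<dots> \<le> \<delta> * (exp (l * s) * (1 + (norm x)\<^sup>2))"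
          using \<rho>(2) that(1) \<delta> M0 \<open>exp (- (l * T)) \<le> exp (l * s)\<close>
          by (intro mult_left_mono mult_mono) auto
        also have "\<dots> \<le> ?B x s"
          using K0 bump_pos[of 0 k x] unfolding bump1 by simp
        finally show ?thesis unfolding \<phi> using bound[OF that(2,3), of x] by linarith
      qed
      fix x :: "real^'n" and s assume s: "norm (x - 0) < \<rho>" "- T < s" "s \<le> 0"
      define D where "D = (\<sigma> * K) *\<^sub>R (\<lambda>(x, t). exp (l * t) *\<^sub>R bump_hess 0 k x) (x, s) +
           (\<sigma> * \<delta>) *\<^sub>R (\<lambda>(x, t). exp (l * t) *\<^sub>R bump_hess 0 1 x) (x, s)"
      have "transpose D = D"
        using transpose_bump_hess[of 0 k x] transpose_bump_hess[of 0 1 x]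
        by (simp add: D_def transpose_def vec_eq_iff)
      moreover have "norm (D *v h) \<le> ((L k + L 1) * ?B x s) * norm h" for h
      proof -
        have "D *v h = (\<sigma> * K * exp (l * s)) *\<^sub>R (bump_hess 0 k x *v h) +
            (\<sigma> * \<delta> * exp (l * s)) *\<^sub>R (bump_hess 0 1 x *v h)"
          by (simp add: D_def matrix_vector_mult_add_rdistrib scaleR_matrix_vector_assoc[symmetric])
        hence "norm (D *v h) \<le> norm ((\<sigma> * K * exp (l * s)) *\<^sub>R (bump_hess 0 k x *v h)) +
            norm ((\<sigma> * \<delta> * exp (l * s)) *\<^sub>R (bump_hess 0 1 x *v h))"
          by (simp only: norm_triangle_ineq)
        also have "\<dots> = (K * exp (l * s)) * norm (bump_hess 0 k x *v h) +
            (\<delta> * exp (l * s)) * norm (bump_hess 0 1 x *v h)"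
          using K0 \<delta> \<sigma>2 by (simp add: abs_mult)
        also have "\<dots> \<le> (K * exp (l * s)) * (L k * bump 0 k x * norm h) +
            (\<delta> * exp (l * s)) * (L 1 * bump 0 1 x * norm h)"
          using K0 \<delta> unfolding L_def by (intro add_mono mult_left_mono norm_bump_hess_le) auto
        also have "\<dots> \<le> (K * exp (l * s)) * ((L k + L 1) * bump 0 k x * norm h) +
            (\<delta> * exp (l * s)) * ((L k + L 1) * bump 0 1 x * norm h)"
          using K0 \<delta> L0[of k] L0[of 1] bump_pos[of 0 k x] bump_pos[of 0 1 x]
          by (intro add_mono mult_left_mono mult_right_mono) auto
        finally show ?thesis by (simp only: algebra_simps)
      qed
      ultimately have "\<bar>sum_arctan (A + D) - sum_arctan A\<bar> \<le> 4 * CARD('n) * ((L k + L 1) * ?B x s)"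
        by (intro sum_arctan_perturbation A) auto
      also have "\<dots> = (l - 1) * ?B x s" by (simp add: l_def)
      finally have "\<bar>sum_arctan (A + D) - \<tau>\<bar> \<le> (l - 1) * ?B x s" by (simp only: \<tau>)
      moreover have "\<sigma> * (sum_arctan (A + D) + f (x, s)) \<le> \<sigma> * \<tau> + \<bar>sum_arctan (A + D) - \<tau>\<bar> + \<bar>f (x, s)\<bar>"
        using \<sigma> by auto
      \<comment> \<open>The decaying part of the spare copy of the barrier covers \<open>f\<close>;
        the \<delta>-part makes the inequality strict.\<close>
      moreover have "0 < \<delta> * (exp (l * s) * bump 0 1 x)" using \<delta> bump_pos[of 0 1 x] by simp
      ultimately have "\<sigma> * (sum_arctan (A + D) + f (x, s)) < \<sigma> * \<tau> + ((l - 1) * ?B x s + ?B x s)"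
        using f_le[of s x] s by linarith
      also have "\<dots> = \<sigma> * \<tau> + (\<sigma> * \<sigma>) * l * ?B x s" unfolding \<sigma>2 by (simp only: algebra_simps)
      also have "\<dots> = \<sigma> * (\<tau> + ((\<sigma> * K) * (\<lambda>(x, t). l * (exp (l * t) * bump 0 k x)) (x, s) +
          (\<sigma> * \<delta>) * (\<lambda>(x, t). l * (exp (l * t) * bump 0 1 x)) (x, s)))"
        by (simp add: algebra_simps)
      finally show "\<sigma> * (sum_arctan (A + ((\<sigma> * K) *\<^sub>R (\<lambda>(x, t). exp (l * t) *\<^sub>R bump_hess 0 k x) (x, s) +
           (\<sigma> * \<delta>) *\<^sub>R (\<lambda>(x, t). exp (l * t) *\<^sub>R bump_hess 0 1 x) (x, s))) + f (x, s)) < \<dots>"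
        unfolding D_def .
    qed (use t \<rho> in auto)
    hence "\<sigma> * (u (x, t) - quad \<tau> A b c x t) \<le> ?B x t" unfolding \<phi> by simp
    also have "\<dots> \<le> K * (1 * bump 0 k x) + \<delta> * (1 * bump 0 1 x)"
      using K0 \<delta> bump_pos[of 0 k x] bump_pos[of 0 1 x] t l0
      by (intro add_mono mult_left_mono mult_right_mono) (auto simp: mult_nonneg_nonpos)
    finally show ?thesis by simp
  qed
  have "\<sigma> * (u (x, t) - quad \<tau> A b c x t) \<le> K * norm x powr (- \<zeta>)"
    if "x \<noteq> 0" "- T < t" "t \<le> 0" for x t
  proof -
    have "\<sigma> * (u (x, t) - quad \<tau> A b c x t) \<le> K * bump 0 k x"
    \<comment> \<open>At fixed \<open>x\<close> the growing term is removed by letting \<delta> tend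
      to 0.\<close>
    proof (rule field_le_epsilon)
      fix e :: real assume "e > 0"
      thus "\<sigma> * (u (x, t) - quad \<tau> A b c x t) \<le> K * bump 0 k x + e"
        using main[of t "e / bump 0 1 x" x] that bump_pos[of 0 1 x] by simp
    qed
    also have "bump 0 k x \<le> (norm x powr 2) powr k"
      unfolding bump_def using that k
      by (intro powr_mono2') (auto simp: power2_norm_eq_inner)
    also have "(norm x powr 2) powr k = norm x powr (- \<zeta>)" by (simp only: powr_powr k_def) simp
    finally show ?thesis using K0 by simp
  qed
  thus ?thesis using K0 by blast
qed

section \<open>Translation in time and the support of the source term\<close>

text \<open>Touching is tested only at earlier times, so a function touching \<open>v\<close> at t0
  corresponds to one touching \<open>u\<close> at t0 - T, whatever its extension does after -
  T.\<close>

lemma signed_subsolution_time_shift: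
  assumes sub: "signed_subsolution \<sigma> f u" and T: "T \<ge> 0"
    and v: "\<And>x t. t \<le> 0 \<Longrightarrow> v (x, t) = u (x, t - T)"
    and f: "\<And>x t. t \<le> - T \<Longrightarrow> f (x, t) = 0"
    and vC: "continuous_on Rminus v"
  shows "signed_subsolution \<sigma> (\<lambda>_. 0) v"
  unfolding signed_subsolution_def
proof (intro conjI vC allI impI)
  fix \<phi> p g H x0 t0
  assume C21: "C21_with \<phi> p g H" and z: "(x0, t0) \<in> Rminus"
    and max: "local_max_at (\<lambda>z. \<sigma> * (v z - \<phi> z)) x0 t0"
  obtain \<phi>' p' g' H' where C21': "C21_with \<phi>' p' g' H'"
    and eq: "\<And>x t. t \<le> 0 \<Longrightarrow> \<phi>' (x, t - T) = \<phi> (x, t)"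
      "\<And>x t. t \<le> 0 \<Longrightarrow> p' (x, t - T) = p (x, t)" "\<And>x t. t \<le> 0 \<Longrightarrow> H' (x, t - T) = H (x, t)"
    using C21_with_time_shift[OF C21 T] by metis
  have t0: "t0 \<le> 0" using z by (simp add: Rminus_def)
  from max obtain r where r: "r > 0"
    "\<And>x t. (x, t) \<in> parabolic_cylinder x0 t0 r \<Longrightarrow> \<sigma> * (v (x, t) - \<phi> (x, t)) \<le> \<sigma> * (v (x0, t0) - \<phi> (x0, t0))"
    unfolding local_max_at_def by blast
  have "local_max_at (\<lambda>z. \<sigma> * (u z - \<phi>' z)) x0 (t0 - T)"
    unfolding local_max_at_def
  proof (intro exI conjI ballI)
    fix z assume "z \<in> parabolic_cylinder x0 (t0 - T) r"
    then obtain x t where xt: "z = (x, t)" "(x, t + T) \<in> parabolic_cylinder x0 t0 r"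
      by (auto simp: parabolic_cylinder_def)
    hence "t + T \<le> 0" using t0 by (auto simp: parabolic_cylinder_def)
    thus "\<sigma> * (u z - \<phi>' z) \<le> \<sigma> * (u (x0, t0 - T) - \<phi>' (x0, t0 - T))"
      using r(2)[OF xt(2)] v[of "t + T" x] v[OF t0, of x0] eq(1)[of "t + T" x] eq(1)[OF t0, of x0]
      by (simp add: xt(1))
  qed (fact r(1))
  moreover have "(x0, t0 - T) \<in> Rminus" using t0 T by (simp add: Rminus_def)
  ultimately have "\<sigma> * p' (x0, t0 - T) \<le> \<sigma> * (sum_arctan (H' (x0, t0 - T)) + f (x0, t0 - T))"
    using sub C21' unfolding signed_subsolution_def by blast
  thus "\<sigma> * p (x0, t0) \<le> \<sigma> * (sum_arctan (H (x0, t0)) + 0)" using eq t0 f by simp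
qed

lemma compactly_supported_bounds:
  fixes f :: "(real^'n) \<times> real \<Rightarrow> real"
  assumes cont: "f \<in> C0_minus" and supp: "compactly_supported f"
  obtains S R where "\<And>x t. t \<le> 0 \<Longrightarrow> \<bar>f (x, t)\<bar> \<le> S"
    "\<And>x t. t \<le> 0 \<Longrightarrow> norm x > R \<Longrightarrow> f (x, t) = 0"
    "\<And>x t. t \<le> 0 \<Longrightarrow> f (x, t) \<noteq> 0 \<Longrightarrow> - t \<le> R"
proof -
  let ?Z = "closure {z \<in> Rminus. f z \<noteq> 0}"
  have "closed (Rminus :: ((real^'n) \<times> real) set)"
    unfolding Rminus_def by (intro closed_Times) auto
  hence "?Z \<subseteq> Rminus" by (intro closure_minimal) auto
  hence "compact (f ` ?Z)"
    using cont supp unfolding C0_minus_def compactly_supported_def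
    by (intro compact_continuous_image) (auto intro: continuous_on_subset)
  from compact_imp_bounded[OF this] obtain S where S: "\<And>z. z \<in> ?Z \<Longrightarrow> \<bar>f z\<bar> \<le> S"
    unfolding bounded_iff by auto
  have "bounded ?Z"
    using supp unfolding compactly_supported_def by (rule compact_imp_bounded)
  then obtain R where R: "\<And>z. z \<in> ?Z \<Longrightarrow> norm z \<le> R"
    unfolding bounded_iff by blast
  have Z: "(x, t) \<in> ?Z" if "t \<le> 0" "f (x, t) \<noteq> 0" for x t
    using that closure_subset[of "{z \<in> Rminus. f z \<noteq> 0}"] by (auto simp: Rminus_def)
  show ?thesis
  proof
    fix x :: "real^'n" and t :: real assume t: "t \<le> 0"
    \<comment> \<open>If the support is empty, \<open>S\<close> may be negative; the absolute value
      also covers points where \<open>f\<close> vanishes.\<close>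
    show "\<bar>f (x, t)\<bar> \<le> \<bar>S\<bar>"
      using S[of "(x, t)"] Z[OF t, of x] by (cases "f (x, t) = 0") auto
    show "f (x, t) = 0" if "norm x > R"
      using R[of "(x, t)"] Z[OF t, of x] norm_fst_le[of x t] that by force
    show "- t \<le> R" if "f (x, t) \<noteq> 0"
      using R[OF Z[OF t that]] norm_snd_le[of t x] t by simp
  qed
qed

text \<open>Strictly before - T this is the definition of the supremum; at - T itself it follows by
  continuity from earlier times. The endpoint matters because it is the final time of the translated
  solution, where the equation must hold too.\<close>

lemma zero_before_time_extent:
  fixes f :: "(real^'n) \<times> real \<Rightarrow> real"
  assumes cont: "f \<in> C0_minus" and supp: "compactly_supported f" and t: "t \<le> - time_extent f"
  shows "time_extent f \<ge> 0" and "f (x, t) = 0"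
proof -
  let ?X = "insert 0 {- t | x t. (x, t) \<in> Rminus \<and> f (x, t) \<noteq> 0}"
  obtain R where R: "\<And>x t. t \<le> 0 \<Longrightarrow> f (x, t) \<noteq> 0 \<Longrightarrow> - t \<le> R"
    using compactly_supported_bounds[OF cont supp] by metis
  have "s \<le> max 0 R" if "s \<in> ?X" for s
    using that R by (fastforce simp: Rminus_def)
  hence bdd: "bdd_above ?X" by (rule bdd_aboveI)
  show T0: "time_extent f \<ge> 0"
    unfolding time_extent_def by (rule cSup_upper[OF insertI1 bdd])
  have zero: "f (x, s) = 0" if "s < - time_extent f" for s
  proof (rule ccontr)
    assume "f (x, s) \<noteq> 0"
    hence "- s \<in> ?X" using that T0 by (auto simp: Rminus_def)
    from cSup_upper[OF this bdd] that show False by (simp add: time_extent_def)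
  qed
  have "continuous_on {..0} (\<lambda>s. f (x, s))"
  proof (rule continuous_on_compose2[of Rminus f])
    show "continuous_on Rminus f" using cont by (simp add: C0_minus_def)
  qed (auto simp: Rminus_def intro!: continuous_intros)
  hence "continuous (at t within {..0}) (\<lambda>s. f (x, s))"
    using t T0 by (simp add: continuous_on_eq_continuous_within)
  hence "continuous (at t within {..<t}) (\<lambda>s. f (x, s))"
    by (rule continuous_within_subset) (use t T0 in auto)
  hence "((\<lambda>s. f (x, s)) \<longlongrightarrow> f (x, t)) (at_left t)"
    by (simp add: continuous_within)
  moreover have "eventually (\<lambda>s. f (x, s) = 0) (at_left t)"
    using zero t by (auto simp: eventually_at_filter)
  hence "((\<lambda>s. f (x, s)) \<longlongrightarrow> 0) (at_left t)"
    by (rule tendsto_eventually)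
  ultimately show "f (x, t) = 0"
    using tendsto_unique[OF trivial_limit_at_left_real] by blast
qed

theorem theorem1p4:
  fixes f u :: "(real^'n) \<times> real \<Rightarrow> real"
    and \<C> :: "((real^'n) \<times> real \<Rightarrow> real) set"
    and T :: real
  assumes dim: "CARD('n) \<ge> 2"
    and f_cont: "f \<in> C0_minus"
    and f_supp: "compactly_supported f"
    and T_def: "T = time_extent f"
    and u_cont: "u \<in> C0_minus"
    and u_sol: "viscosity_solution f u"
    and class_sub: "\<C> \<subseteq> C0_minus"
    and rigidity: "\<forall>v\<in>\<C>. viscosity_solution (\<lambda>_. 0) v \<longrightarrow>
          (\<exists>A\<in>Sym. \<exists>b c. \<forall>x t. (x, t) \<in> Rminus \<longrightarrow> v (x, t) = quad (sum_arctan A) A b c x t)"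
    and u_class: "\<exists>v\<in>\<C>. \<forall>x t. (x, t) \<in> Rminus \<longrightarrow> v (x, t) = u (x, t - T)"
  shows "\<exists>A\<in>Sym. \<exists>b c. \<forall>\<zeta>>0. \<exists>C>0. \<forall>x t. x \<noteq> 0 \<and> - T < t \<and> t \<le> 0 \<longrightarrow>
           \<bar>u (x, t) - quad (sum_arctan A) A b c x t\<bar> \<le> C * norm x powr (- \<zeta>)"
proof -
  have T: "T \<ge> 0" and fT: "\<And>x t. t \<le> - T \<Longrightarrow> f (x, t) = 0"
    using zero_before_time_extent[OF f_cont f_supp] T_def by auto
  obtain v where v: "v \<in> \<C>" "\<And>x t. t \<le> 0 \<Longrightarrow> v (x, t) = u (x, t - T)"
    using u_class by (auto simp: Rminus_def)
  have sub: "signed_subsolution 1 f u" "signed_subsolution (- 1) f u"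
    using u_sol by (auto simp: viscosity_solution_iff_signed)
  have "continuous_on Rminus v" using v(1) class_sub by (auto simp: C0_minus_def)
  hence "signed_subsolution \<sigma> (\<lambda>_. 0) v" if "signed_subsolution \<sigma> f u" for \<sigma>
    using signed_subsolution_time_shift[where T = T and f = f and u = u and v = v] that T v(2) fT
    by blast
  hence "viscosity_solution (\<lambda>_. 0) v"
    unfolding viscosity_solution_iff_signed using sub by blast
  then obtain A b c where A: "A \<in> Sym"
    and v_eq: "\<And>x t. t \<le> 0 \<Longrightarrow> v (x, t) = quad (sum_arctan A) A b c x t"
    using rigidity v(1) by (fastforce simp: Rminus_def)
  define \<tau> where "\<tau> = sum_arctan A"
  \<comment> \<open>Undoes the translation: time 0 of \<open>v\<close> is time - T of
    \<open>u\<close>. The slice there supplies the initial data, and \<open>A\<close>,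
    \<open>b\<close>, \<open>c'\<close> are fixed before \<zeta>.\<close>
  define c' where "c' = c + \<tau> * T"
  have symA: "transpose A = A" using A by (simp add: Sym_def)
  have init: "u (x, - T) = quad \<tau> A b c' x (- T)" for x
    using v(2)[of 0 x] v_eq[of 0 x] by (simp add: quad_def c'_def \<tau>_def)
  obtain S R where f: "\<And>x t. t \<le> 0 \<Longrightarrow> \<bar>f (x, t)\<bar> \<le> S"
    "\<And>x t. t \<le> 0 \<Longrightarrow> norm x > R \<Longrightarrow> f (x, t) = 0"
    using compactly_supported_bounds[OF f_cont f_supp] by metis
  have "\<exists>C>0. \<forall>x t. x \<noteq> 0 \<and> - T < t \<and> t \<le> 0 \<longrightarrow>
      \<bar>u (x, t) - quad \<tau> A b c' x t\<bar> \<le> C * norm x powr (- \<zeta>)" if \<zeta>: "\<zeta> > 0" for \<zeta>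
  proof -
    have decay: "\<exists>C>0. \<forall>x t. x \<noteq> 0 \<and> - T < t \<and> t \<le> 0 \<longrightarrow>
        \<sigma> * (u (x, t) - quad \<tau> A b c' x t) \<le> C * norm x powr (- \<zeta>)"
      if "signed_subsolution \<sigma> f u" "\<sigma> \<in> {1, - 1}" for \<sigma>
      by (rule deviation_decay[OF that symA \<tau>_def f init T \<zeta>])
    obtain C1 where C1: "C1 > 0" "\<And>x t. x \<noteq> 0 \<Longrightarrow> - T < t \<Longrightarrow> t \<le> 0 \<Longrightarrow>
        1 * (u (x, t) - quad \<tau> A b c' x t) \<le> C1 * norm x powr (- \<zeta>)"
      using decay[OF sub(1)] by auto
    obtain C2 where C2: "C2 > 0" "\<And>x t. x \<noteq> 0 \<Longrightarrow> - T < t \<Longrightarrow> t \<le> 0 \<Longrightarrow>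
        - 1 * (u (x, t) - quad \<tau> A b c' x t) \<le> C2 * norm x powr (- \<zeta>)"
      using decay[OF sub(2)] by auto
    have "\<bar>u (x, t) - quad \<tau> A b c' x t\<bar> \<le> (C1 + C2) * norm x powr (- \<zeta>)"
      if "x \<noteq> 0" "- T < t" "t \<le> 0" for x t
    proof -
      have "0 \<le> C1 * norm x powr (- \<zeta>)" "0 \<le> C2 * norm x powr (- \<zeta>)"
        using C1(1) C2(1) by simp_all
      thus ?thesis using C1(2)[OF that] C2(2)[OF that] by (simp add: distrib_right)
    qed
    moreover have "C1 + C2 > 0" using C1(1) C2(1) by simp
    ultimately show ?thesis by blast
  qed
  thus ?thesis using A unfolding \<tau>_def by blast
qed
end
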